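(* Let $H\in(0,1]$, $\sigma>0$, let $\{B_H(t)\}_{t\in\mathbb{R}}$ be a fractional Brownian motion with Hurst parameter $H$, let $p\ge 2$, and let $\lambda_1,\dots,\lambda_p$ be pairwise different positive real numbers. If $\{X_t\}_{t\in\mathbb{R}}\sim\mathrm{FOU}(\lambda_1,\dots,\lambda_p,\sigma,H)$, then for all $t\in\mathbb{R}$ $$\mathbb{E}(X_0X_t)=\frac{\sigma^2H}{2}\sum_{i=1}^{p}\frac{\lambda_i^{2p-2H-2}}{\prod_{j\neq i}(\lambda_i^2-\lambda_j^2)}\,f_H(\lambda_i|t|).$$
   Context: A fractional Brownian motion with Hurst parameter $H\in(0,1]$ is an almost surely continuous centered Gaussian process $\{B_H(t)\}_{t\in\mathbb{R}}$ with $\mathbb{E}(B_H(t)B_H(s))=\frac12(|t|^{2H}+|s|^{2H}-|t-s|^{2H})$ for $t,s\in\mathbb{R}$. For $\lambda>0$ and a continuous process $y=\{y(t)\}_{t\in\mathbb{R}}$ for which the integral exists, $T_\lambda(y)(t)=\int_{-\infty}^{t}e^{-\lambda(t-s)}\,dy(s)$ (pathwise improper Riemann–Stieltjes integral). For pairwise different $\lambda_1,\dots,\lambda_p>0$, $\{X_t\}_{t\in\mathbb{R}}\sim\mathrm{FOU}(\lambda_1,\dots,\lambda_p,\sigma,H)$ means that $$X_t=(T_{\lambda_1}\circ\cdots\circ T_{\lambda_p})(\sigma B_H)(t)=\sum_{i=1}^{p}K_i\,T_{\lambda_i}(\sigma B_H)(t),\qquad K_i=\frac{1}{\prod_{j\neq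 i}(1-\lambda_j/\lambda_i)}.$$ For $x\ge0$, $$f_H(x)=e^{-x}\Big(\Gamma(2H)-\int_0^xe^{s}s^{2H-1}ds\Big)+e^{x}\Big(\Gamma(2H)-\int_0^xe^{-s}s^{2H-1}ds\Big).$$ *)

theory Defs
  imports "HOL-Probability.Probability"
begin

text \<open>The degenerate (Dirac) laws count as Gaussian; they are not covered by
  \<^const>\<open>normal_density\<close>, which needs a positive standard deviation.\<close>

definition gaussian_law :: "real measure \<Rightarrow> bool" where
  "gaussian_law N \<longleftrightarrow>
     (\<exists>\<mu>. N = return borel \<mu>) \<or>
     (\<exists>\<mu> s. s > 0 \<and> N = density lborel (\<lambda>x. ennreal (normal_density \<mu> s x)))"

definition gaussian_process :: "'a measure \<Rightarrow> (real \<Rightarrow> 'a \<Rightarrow> real) \<Rightarrow> bool" where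
  "gaussian_process M Y \<longleftrightarrow>
     (\<forall>t. Y t \<in> borel_measurable M) \<and>
     (\<forall>J a. finite J \<longrightarrow> gaussian_law (distr M borel (\<lambda>\<omega>. \<Sum>t\<in>J. a t * Y t \<omega>)))"

definition fractional_brownian_motion ::
    "'a measure \<Rightarrow> real \<Rightarrow> (real \<Rightarrow> 'a \<Rightarrow> real) \<Rightarrow> bool" where
  "fractional_brownian_motion M H B \<longleftrightarrow>
     0 < H \<and> H \<le> 1 \<and>
     gaussian_process M B \<and>
     (AE \<omega> in M. continuous_on UNIV (\<lambda>t. B t \<omega>)) \<and>
     (\<forall>t. (\<integral>\<omega>. B t \<omega> \<partial>M) = 0) \<and>
     (\<forall>t s. (\<integral>\<omega>. B t \<omega> * B s \<omega> \<partial>M) =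
        (\<bar>t\<bar> powr (2 * H) + \<bar>s\<bar> powr (2 * H) - \<bar>t - s\<bar> powr (2 * H)) / 2)"

text \<open>Riemann--Stieltjes integral of \<open>g\<close> against \<open>y\<close> over \<open>[a, b]\<close>. Taking the radius \<open>d\<close>
  independent of the tag (instead of an arbitrary gauge) makes this the limit as the mesh tends
  to zero, hence the Riemann rather than the Henstock--Kurzweil notion.\<close>

definition has_rs_integral ::
    "(real \<Rightarrow> real) \<Rightarrow> (real \<Rightarrow> real) \<Rightarrow> real \<Rightarrow> real \<Rightarrow> real \<Rightarrow> bool" where
  "has_rs_integral g y a b v \<longleftrightarrow>
     (\<forall>e>0. \<exists>d>0. \<forall>D. D tagged_division_of {a..b} \<and> (\<lambda>x. ball x d) fine D \<longrightarrow>
        \<bar>(\<Sum>(x, K)\<in>D. g x * (y (Sup K) - y (Inf K))) - v\<bar> < e)"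

definition has_improper_rs_integral ::
    "(real \<Rightarrow> real) \<Rightarrow> (real \<Rightarrow> real) \<Rightarrow> real \<Rightarrow> real \<Rightarrow> bool" where
  "has_improper_rs_integral g y t v \<longleftrightarrow>
     (\<exists>I. (\<forall>a\<le>t. has_rs_integral g y a t (I a)) \<and> (I \<longlongrightarrow> v) at_bot)"

text \<open>The value is unspecified for paths \<open>y\<close> whose integral does not exist.\<close>

definition T_op :: "real \<Rightarrow> (real \<Rightarrow> real) \<Rightarrow> real \<Rightarrow> real" where
  "T_op l y t = (THE v. has_improper_rs_integral (\<lambda>s. exp (- l * (t - s))) y t v)"

text \<open>\<open>T_comp l p\<close> is \<open>T_op (l 1) \<circ> \<dots> \<circ> T_op (l p)\<close>.\<close>

definition T_comp :: "(nat \<Rightarrow> real) \<Rightarrow> nat \<Rightarrow> (real \<Rightarrow> real) \<Rightarrow> real \<Rightarrow> real" where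
  "T_comp l p = foldr (\<lambda>i. T_op (l i)) [1..<Suc p]"

text \<open>The process \<open>X\<close> is the one driven by the given fractional Brownian motion \<open>B\<close>. The
  operators act path by path; the representation of \<open>T_comp\<close> as a linear combination of the
  \<open>T_op (l i)\<close> is a consequence and is not part of the definition.\<close>

definition FOU ::
    "'a measure \<Rightarrow> (real \<Rightarrow> 'a \<Rightarrow> real) \<Rightarrow> nat \<Rightarrow> (nat \<Rightarrow> real) \<Rightarrow> real \<Rightarrow>
     (real \<Rightarrow> 'a \<Rightarrow> real) \<Rightarrow> bool" where
  "FOU M B p l \<sigma> X \<longleftrightarrow>
     (\<forall>t. X t \<in> borel_measurable M \<and>
          (AE \<omega> in M. X t \<omega> = T_comp l p (\<lambda>s. \<sigma> * B s \<omega>) t))"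

definition f_cov :: "real \<Rightarrow> real \<Rightarrow> real" where
  "f_cov H x =
     exp (- x) * (Gamma (2 * H) - integral {0..x} (\<lambda>s. exp s * s powr (2 * H - 1))) +
     exp x * (Gamma (2 * H) - integral {0..x} (\<lambda>s. exp (- s) * s powr (2 * H - 1)))"

end

theory Submission imports Defs "HOL-Real_Asymp.Real_Asymp" begin

text \<open>On paths of at most cubic growth, integration by parts turns \<open>T\<^sub>\<lambda>\<close> into \<open>y - A\<^sub>\<lambda> y\<close>, where
  \<open>A\<^sub>\<lambda> y t\<close> is the mean of \<open>y (t - v)\<close> over an exponential time \<open>v\<close> of rate \<open>\<lambda>\<close>. Moreover
  \<open>A\<^sub>\<lambda> y\<close> is the only solution of cubic growth of \<open>z' = \<lambda> (y - z)\<close>; this uniqueness replaces every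
  resolvent computation, in particular \<open>(a - b) T\<^sub>a T\<^sub>b = a T\<^sub>a - b T\<^sub>b\<close>, so partial fractions give
  \<open>X\<^sub>t = \<Sum> K\<^sub>i T\<^sub>\<lambda>\<^sub>i (\<sigma> B) t\<close>. Fractional Brownian paths have cubic growth almost surely by a
  Kolmogorov chaining argument with a high Gaussian moment.

  As \<open>T\<^sub>\<lambda>\<close> annihilates constants, only the term \<open>-\<bar>t - s\<bar>\<^sup>2\<^sup>H / 2\<close> of the covariance survives.
  With \<open>\<phi> u = \<bar>u\<bar>\<^sup>2\<^sup>H\<close>, Fubini's theorem and the uniqueness principle express
  \<open>E (T\<^sub>a B 0 * T\<^sub>b B t)\<close> through \<open>A\<^sub>a \<phi> (- t)\<close> and \<open>A\<^sub>b \<phi> t\<close> separately; summing over \<open>a, b\<close> by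
  partial fractions leaves \<open>A\<^sub>\<lambda> \<phi> t + A\<^sub>\<lambda> \<phi> (- t) - 2 \<phi> t\<close>, a multiple of \<open>f\<^sub>H (\<lambda> \<bar>t\<bar>)\<close>.\<close>

section \<open>Exponential means\<close>

text \<open>The exponent 3 is what chaining yields for sample paths: oscillation of order
  \<open>n^2\<close> on the n-th unit interval, accumulated over n intervals. It also covers
  \<open>fbm_var H\<close>, as 2H \<le> 2.\<close>

definition subcubic :: "(real \<Rightarrow> real) \<Rightarrow> bool" where
  "subcubic y \<longleftrightarrow> continuous_on UNIV y \<and> (\<exists>C. \<forall>s. \<bar>y s\<bar> \<le> C * (1 + \<bar>s\<bar>) ^ 3)"

abbreviation exp_law :: "real \<Rightarrow> real measure" where
  "exp_law l \<equiv> density lborel (\<lambda>v. ennreal (exponential_density l v))"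

text \<open>Integrating against a probability law, rather than a kernel on a half-line, makes Fubini
  and Jensen directly available.\<close>

definition expmean :: "real \<Rightarrow> (real \<Rightarrow> real) \<Rightarrow> real \<Rightarrow> real" where
  "expmean l y t = (\<integral>v. y (t - v) \<partial>exp_law l)"

lemma subcubicI:
  assumes "continuous_on UNIV y" "\<And>s. \<bar>y s\<bar> \<le> C * (1 + \<bar>s\<bar>) ^ 3"
  shows "subcubic y"
  using assms unfolding subcubic_def by blast

lemma subcubicE:
  assumes "subcubic y"
  obtains C where "C > 0" "\<And>s. \<bar>y s\<bar> \<le> C * (1 + \<bar>s\<bar>) ^ 3"
proof -
  obtain C where C: "\<And>s. \<bar>y s\<bar> \<le> C * (1 + \<bar>s\<bar>) ^ 3"
    using assms unfolding subcubic_def by blast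
  have "\<bar>y s\<bar> \<le> (\<bar>C\<bar> + 1) * (1 + \<bar>s\<bar>) ^ 3" for s
    by (rule order_trans[OF C]) (auto intro!: mult_right_mono)
  then show thesis by (intro that[of "\<bar>C\<bar> + 1"]) auto
qed

lemma subcubic_continuous: "subcubic y \<Longrightarrow> continuous_on A y"
  using continuous_on_subset unfolding subcubic_def by blast

lemma subcubic_measurable [measurable_dest]: "subcubic y \<Longrightarrow> y \<in> borel_measurable borel"
  using subcubic_continuous[of y UNIV] by (rule borel_measurable_continuous_onI)

lemma subcubic_cmult: "subcubic y \<Longrightarrow> subcubic (\<lambda>s. c * y s)"
proof -
  assume y: "subcubic y"
  then obtain C where C: "\<And>s. \<bar>y s\<bar> \<le> C * (1 + \<bar>s\<bar>) ^ 3" by (rule subcubicE) blast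
  show ?thesis
  proof (rule subcubicI)
    show "continuous_on UNIV (\<lambda>s. c * y s)" using subcubic_continuous[OF y] by (intro continuous_intros)
    show "\<bar>c * y s\<bar> \<le> (\<bar>c\<bar> * C) * (1 + \<bar>s\<bar>) ^ 3" for s
      using mult_left_mono[OF C[of s], of "\<bar>c\<bar>"] by (simp add: abs_mult ac_simps)
  qed
qed

lemma subcubic_add: "subcubic y \<Longrightarrow> subcubic z \<Longrightarrow> subcubic (\<lambda>s. y s + z s)"
proof -
  assume y: "subcubic y" and z: "subcubic z"
  obtain C where C: "\<And>s. \<bar>y s\<bar> \<le> C * (1 + \<bar>s\<bar>) ^ 3" using y by (rule subcubicE) blast
  obtain D where D: "\<And>s. \<bar>z s\<bar> \<le> D * (1 + \<bar>s\<bar>) ^ 3" using z by (rule subcubicE) blast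
  show ?thesis
  proof (rule subcubicI)
    show "continuous_on UNIV (\<lambda>s. y s + z s)"
      using subcubic_continuous[OF y] subcubic_continuous[OF z] by (intro continuous_intros)
    show "\<bar>y s + z s\<bar> \<le> (C + D) * (1 + \<bar>s\<bar>) ^ 3" for s
      using C[of s] D[of s] by (simp add: distrib_right)
  qed
qed

lemma subcubic_diff: "subcubic y \<Longrightarrow> subcubic z \<Longrightarrow> subcubic (\<lambda>s. y s - z s)"
  using subcubic_add[OF _ subcubic_cmult[of z "-1"], of y] by simp

lemma subcubic_sum: "(\<And>i. i \<in> A \<Longrightarrow> subcubic (y i)) \<Longrightarrow> subcubic (\<lambda>s. \<Sum>i\<in>A. y i s)"
proof (induction A rule: infinite_finite_induct)
  case (insert x F)
  then show ?case by (auto intro: subcubic_add)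
qed (auto intro!: subcubicI[of _ 0])

lemma subcubic_reflect: "subcubic y \<Longrightarrow> subcubic (\<lambda>s. y (- s))"
proof -
  assume y: "subcubic y"
  then obtain C where C: "\<And>s. \<bar>y s\<bar> \<le> C * (1 + \<bar>s\<bar>) ^ 3" by (rule subcubicE) blast
  show ?thesis
  proof (rule subcubicI)
    show "continuous_on UNIV (\<lambda>s. y (- s))"
      by (rule continuous_on_compose2[OF subcubic_continuous[OF y, of UNIV]]) (auto intro!: continuous_intros)
    show "\<bar>y (- s)\<bar> \<le> C * (1 + \<bar>s\<bar>) ^ 3" for s using C[of "-s"] by simp
  qed
qed

text \<open>Serves twice: it removes the boundary term at minus infinity in the improper integral,
  and it fixes the constant in \<open>expmean_unique\<close>.\<close>

lemma subcubic_exp_tendsto_0: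
  assumes "subcubic y" "l > 0"
  shows "((\<lambda>s. exp (l * s) * y s) \<longlongrightarrow> 0) at_bot"
proof -
  obtain C where C: "\<And>s. \<bar>y s\<bar> \<le> C * (1 + \<bar>s\<bar>) ^ 3" using assms(1) by (rule subcubicE) blast
  have "((\<lambda>s::real. exp (l * s) * (C * (1 - s) ^ 3)) \<longlongrightarrow> 0) at_bot"
    using assms(2) by real_asymp
  then show ?thesis
  proof (rule Lim_null_comparison[rotated])
    show "\<forall>\<^sub>F s in at_bot. norm (exp (l * s) * y s) \<le> exp (l * s) * (C * (1 - s) ^ 3)"
      using eventually_le_at_bot[of 0]
    proof eventually_elim
      case (elim s)
      then show ?case using C[of s] by (simp add: abs_mult)
    qed
  qed
qed

lemma integrable_exp_law_power:
  assumes "l > 0"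
  shows "integrable (exp_law l) (\<lambda>v. v ^ k)"
proof -
  interpret prob_space "exp_law l" by (rule prob_space_exponential_density) fact
  \<comment> \<open>The exponential law is the Erlang law with shape index 0.\<close>
  show ?thesis
    by (rule erlang_ith_moment_integrable[OF assms, of _ 0])
      (auto simp: distributed_def distr_id2 exponential_density_nonneg[OF assms])
qed

lemma measure_exp_law_UNIV: "l > 0 \<Longrightarrow> measure (exp_law l) UNIV = 1"
  using prob_space.prob_space[OF prob_space_exponential_density, of l] by simp

lemma AE_exp_law_nonneg: "l > 0 \<Longrightarrow> AE v in exp_law l. v \<ge> 0"
  by (subst AE_density) (auto simp: exponential_density_def)

lemma integrable_exp_law_cubic: "l > 0 \<Longrightarrow> integrable (exp_law l) (\<lambda>v. (1 + v) ^ 3)"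
proof -
  assume "l > 0"
  then have "integrable (exp_law l) (\<lambda>v. 1 * v^0 + 3 * v^1 + 3 * v^2 + 1 * v^3)"
    by (intro Bochner_Integration.integrable_add integrable_mult_right integrable_exp_law_power) auto
  then show ?thesis by (simp add: power3_eq_cube power2_eq_square algebra_simps)
qed

text \<open>Submultiplicativity of the weight: the dependence on t factors out and leaves a function
  of v integrable under the exponential law. Hence \<open>expmean\<close> preserves cubic
  growth.\<close>

lemma cubic_shift: "v \<ge> 0 \<Longrightarrow> (1 + \<bar>t - v\<bar>) ^ 3 \<le> (1 + \<bar>t\<bar>) ^ 3 * (1 + v) ^ 3" for t v :: real
proof -
  assume v: "v \<ge> 0"
  have "1 + \<bar>t - v\<bar> \<le> 1 + \<bar>t\<bar> + v" using v by linarith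
  also have "\<dots> \<le> (1 + \<bar>t\<bar>) * (1 + v)" using v by (simp add: algebra_simps)
  finally show ?thesis unfolding power_mult_distrib[symmetric] by (intro power_mono) auto
qed

lemma subcubic_shift_bound:
  fixes y :: "real \<Rightarrow> real"
  assumes "\<And>s. \<bar>y s\<bar> \<le> C * (1 + \<bar>s\<bar>) ^ 3" "C > 0" "v \<ge> 0"
  shows "\<bar>y (t - v)\<bar> \<le> C * (1 + \<bar>t\<bar>) ^ 3 * (1 + v) ^ 3"
proof -
  have "C * (1 + \<bar>t - v\<bar>) ^ 3 \<le> C * ((1 + \<bar>t\<bar>) ^ 3 * (1 + v) ^ 3)"
    using assms(2,3) by (intro mult_left_mono cubic_shift) auto
  with assms(1)[of "t - v"] show ?thesis by (simp add: mult.assoc)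
qed

lemma integrable_exp_law_subcubic:
  assumes "subcubic y" "l > 0"
  shows "integrable (exp_law l) (\<lambda>v. y (t - v))"
proof -
  obtain C where C: "C > 0" "\<And>s. \<bar>y s\<bar> \<le> C * (1 + \<bar>s\<bar>) ^ 3" using assms(1) by (rule subcubicE) blast
  note [measurable] = subcubic_measurable[OF assms(1)]
  show ?thesis
  proof (rule Bochner_Integration.integrable_bound)
    show "integrable (exp_law l) (\<lambda>v. C * (1 + \<bar>t\<bar>) ^ 3 * (1 + v) ^ 3)"
      by (intro integrable_mult_right integrable_exp_law_cubic assms)
    show "AE v in exp_law l. norm (y (t - v)) \<le> norm (C * (1 + \<bar>t\<bar>) ^ 3 * (1 + v) ^ 3)"
      using AE_exp_law_nonneg[OF assms(2)]
    proof eventually_elim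
      case (elim v)
      then show ?case using subcubic_shift_bound[OF C(2) C(1) elim, of t] C(1) by (auto simp: abs_mult)
    qed
  qed simp
qed

lemma expmean_bound:
  assumes "subcubic y" "l > 0"
  shows "\<exists>C. \<forall>t. \<bar>expmean l y t\<bar> \<le> C * (1 + \<bar>t\<bar>) ^ 3"
proof -
  obtain C where C: "C > 0" "\<And>s. \<bar>y s\<bar> \<le> C * (1 + \<bar>s\<bar>) ^ 3" using assms(1) by (rule subcubicE) blast
  have "\<bar>expmean l y t\<bar> \<le> (C * (\<integral>v. (1 + v) ^ 3 \<partial>exp_law l)) * (1 + \<bar>t\<bar>) ^ 3" for t
  proof -
    have "\<bar>expmean l y t\<bar> \<le> (\<integral>v. \<bar>y (t - v)\<bar> \<partial>exp_law l)"
      unfolding expmean_def by (rule integral_abs_bound)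
    also have "\<dots> \<le> (\<integral>v. C * (1 + \<bar>t\<bar>) ^ 3 * (1 + v) ^ 3 \<partial>exp_law l)"
    proof (rule integral_mono_AE)
      show "AE v in exp_law l. \<bar>y (t - v)\<bar> \<le> C * (1 + \<bar>t\<bar>) ^ 3 * (1 + v) ^ 3"
        using AE_exp_law_nonneg[OF assms(2)]
        by eventually_elim (rule subcubic_shift_bound[OF C(2) C(1)])
    qed (intro integrable_abs integrable_mult_right integrable_exp_law_cubic integrable_exp_law_subcubic assms)+
    finally show ?thesis by (simp add: ac_simps)
  qed
  then show ?thesis by blast
qed

text \<open>Substituting s = t - v moves t out of the integrand into an exponential factor and the
  upper limit, so that differentiation in t does not touch y.\<close>

lemma expmean_kernel_form:
  assumes y: "subcubic y" and l: "l > 0"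
  shows "set_integrable lborel {..t} (\<lambda>s. l * exp (l * s) * y s)"
    and "expmean l y t = exp (- l * t) * (LINT s:{..t}|lborel. l * exp (l * s) * y s)"
proof -
  note [measurable] = subcubic_measurable[OF y]
  let ?f = "\<lambda>s. indicator {..t} s * (l * exp (l * s) * y s)"
  have eq: "exponential_density l v *\<^sub>R y (t - v) = exp (- l * t) * ?f (t + (-1) * v)" for v
    by (auto simp: exponential_density_def exp_add[symmetric] exp_diff exp_minus field_simps indicator_def)
  have "integrable lborel (\<lambda>v. exponential_density l v *\<^sub>R y (t - v))"
    using integrable_exp_law_subcubic[OF y l, of t]
    by (subst (asm) integrable_density) (auto simp: exponential_density_nonneg[OF l])
  then have "integrable lborel (\<lambda>v. ?f (t + (-1) * v))"
    unfolding eq by simp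
  then show "set_integrable lborel {..t} (\<lambda>s. l * exp (l * s) * y s)"
    unfolding set_integrable_def by (subst (asm) lborel_integrable_real_affine_iff) auto
  have "expmean l y t = (\<integral>v. exponential_density l v *\<^sub>R y (t - v) \<partial>lborel)"
    unfolding expmean_def by (subst integral_density) (auto simp: exponential_density_nonneg[OF l])
  also have "\<dots> = exp (- l * t) * (\<integral>v. ?f (t + (-1) * v) \<partial>lborel)"
    unfolding eq by simp
  also have "(\<integral>v. ?f (t + (-1) * v) \<partial>lborel) = (\<integral>s. ?f s \<partial>lborel)"
    by (subst (2) lborel_integral_real_affine[of "-1" _ t]) auto
  finally show "expmean l y t = exp (- l * t) * (LINT s:{..t}|lborel. l * exp (l * s) * y s)"
    by (simp add: set_lebesgue_integral_def)
qed

lemma expmean_has_derivative: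
  assumes y: "subcubic y" and l: "l > 0"
  shows "(expmean l y has_real_derivative l * (y t - expmean l y t)) (at t)"
proof -
  define g where "g s = l * exp (l * s) * y s" for s
  define F where "F t = (LINT s:{..t}|lborel. g s)" for t
  have em: "expmean l y = (\<lambda>t. exp (- l * t) * F t)"
    using expmean_kernel_form(2)[OF y l] by (auto simp: F_def g_def)
  have int: "set_integrable lborel {..t} g" for t
    using expmean_kernel_form(1)[OF y l] by (simp add: g_def[abs_def])
  have contg: "continuous_on A g" for A
    unfolding g_def using subcubic_continuous[OF y] by (intro continuous_intros)
  \<comment> \<open>Splitting at the fixed point t - 1 leaves a compact interval for the fundamental
    theorem of calculus; the tail \<open>F (t - 1)\<close> is constant.\<close>
  have F: "F x = F (t - 1) + integral {t - 1..x} g" if "x \<in> {t-1..t+1}" for x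
  proof -
    have *: "set_integrable lborel {t - 1<..x} g"
      by (rule set_integrable_subset[OF int[of x]]) auto
    have "F x = (LINT s:{..t-1} \<union> {t-1<..x}|lborel. g s)"
      unfolding F_def using that by (simp add: ivl_disj_un)
    also have "\<dots> = F (t - 1) + (LINT s:{t-1<..x}|lborel. g s)"
      unfolding F_def by (rule set_integral_Un) (use int * in auto)
    also have "(LINT s:{t-1<..x}|lborel. g s) = integral {t - 1..x} g"
    proof -
      have "(LINT s:{t-1<..x}|lborel. g s) = (LINT s:{t-1..x}|lborel. g s)"
        using that interval_integral_Icc[of "t-1" x g] interval_integral_Ioc[of "t-1" x g] by simp
      also have "\<dots> = integral {t - 1..x} g"
        by (rule set_borel_integral_eq_integral(2), rule set_integrable_subset[OF int[of x]]) auto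
      finally show ?thesis .
    qed
    finally show ?thesis .
  qed
  have "((\<lambda>x. integral {t-1..x} g) has_real_derivative g t) (at t within {t-1..t+1})"
    by (rule integral_has_real_derivative[OF contg]) auto
  then have "((\<lambda>x. F (t - 1) + integral {t-1..x} g) has_real_derivative g t) (at t within {t-1..t+1})"
    by (auto intro!: derivative_eq_intros)
  then have "(F has_real_derivative g t) (at t within {t-1..t+1})"
    by (rule has_field_derivative_transform_within[where d = 1]) (auto simp: F[symmetric])
  then have dF: "(F has_real_derivative g t) (at t)"
    by (subst (asm) at_within_Icc_at) auto
  have "exp (l * t) * exp (- l * t) = 1" by (simp add: exp_add[symmetric])
  then show ?thesis
    unfolding em by (auto intro!: derivative_eq_intros dF simp: g_def algebra_simps)
qed

lemma subcubic_expmean: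
  assumes "subcubic y" "l > 0"
  shows "subcubic (expmean l y)"
proof -
  obtain C where "\<And>t. \<bar>expmean l y t\<bar> \<le> C * (1 + \<bar>t\<bar>) ^ 3" using expmean_bound[OF assms] by blast
  moreover have "continuous_on UNIV (expmean l y)"
    using DERIV_isCont[OF expmean_has_derivative[OF assms]] by (simp add: continuous_at_imp_continuous_on)
  ultimately show ?thesis by (intro subcubicI)
qed

text \<open>Multiplied by the integrating factor \<open>exp (l * s)\<close>, the difference of two
  solutions is constant; cubic growth makes it tend to 0 at minus infinity, so it vanishes.\<close>

lemma expmean_unique:
  assumes y: "subcubic y" and l: "l > 0" and z: "subcubic z"
    and dz: "\<And>t. (z has_real_derivative l * (y t - z t)) (at t)"
  shows "expmean l y = z"
proof
  fix t
  define d where "d s = exp (l * s) * (z s - expmean l y s)" for s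
  have "DERIV d s :> 0" for s
    unfolding d_def by (auto intro!: derivative_eq_intros dz expmean_has_derivative y l simp: algebra_simps)
  then have const: "d = (\<lambda>s. d t)" using DERIV_isconst_all by blast
  have "(d \<longlongrightarrow> 0) at_bot"
    unfolding d_def by (rule subcubic_exp_tendsto_0[OF subcubic_diff[OF z subcubic_expmean[OF y l]] l])
  then have "((\<lambda>s::real. d t) \<longlongrightarrow> 0) at_bot" by (subst (asm) const)
  then have "d t = 0" by (subst (asm) tendsto_const_iff) (auto simp: trivial_limit_at_bot_linorder)
  then show "expmean l y t = z t" by (simp add: d_def)
qed

section \<open>The operators \<open>T\<^sub>\<lambda>\<close> on paths of cubic growth\<close>

text \<open>For a constant c, \<open>P s - g s * c\<close> has the small derivative
  \<open>g' s * (y s - c)\<close>. Splitting at the tag x, with c = \<open>y u\<close> to its left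
  and c = \<open>y v\<close> to its right, reproduces the Riemann sum term; only the oscillation of
  y enters.\<close>

lemma rs_increment_bound:
  fixes g g' y P :: "real \<Rightarrow> real"
  assumes uv: "u \<le> x" "x \<le> v"
    and dg: "\<And>s. s \<in> {u..v} \<Longrightarrow> (g has_real_derivative g' s) (at s)"
    and dP: "\<And>s. s \<in> {u..v} \<Longrightarrow> (P has_real_derivative g' s * y s) (at s)"
    and G: "\<And>s. s \<in> {u..v} \<Longrightarrow> \<bar>g' s\<bar> \<le> G"
    and w: "\<And>r s. r \<in> {u..v} \<Longrightarrow> s \<in> {u..v} \<Longrightarrow> \<bar>y r - y s\<bar> \<le> w"
  shows "\<bar>g x * (y v - y u) - ((g v * y v - P v) - (g u * y u - P u))\<bar> \<le> G * w * (v - u)"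
proof -
  have *: "\<bar>(P b - g b * c) - (P a - g a * c)\<bar> \<le> G * w * (b - a)"
    if ab: "u \<le> a" "a \<le> b" "b \<le> v" and c: "c = y u \<or> c = y v" for a b c
  proof -
    have "norm ((P b - g b * c) - (P a - g a * c)) \<le> (G * w) * norm (b - a)"
    proof (rule field_differentiable_bound[where S = "{a..b}" and f' = "\<lambda>s. g' s * (y s - c)"])
      fix s assume s: "s \<in> {a..b}"
      then have "s \<in> {u..v}" using ab by auto
      then show "((\<lambda>s. P s - g s * c) has_field_derivative g' s * (y s - c)) (at s within {a..b})"
        by (auto intro!: derivative_eq_intros has_field_derivative_at_within[OF dP]
              has_field_derivative_at_within[OF dg] simp: algebra_simps)
      have "\<bar>y s - c\<bar> \<le> w" using c w[of s u] w[of s v] \<open>s \<in> {u..v}\<close> by auto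
      then show "norm (g' s * (y s - c)) \<le> G * w"
        using G[OF \<open>s \<in> {u..v}\<close>] by (auto simp: abs_mult intro!: mult_mono)
    qed (use ab in auto)
    then show ?thesis using ab by simp
  qed
  have "g x * (y v - y u) - ((g v * y v - P v) - (g u * y u - P u)) =
     ((P v - g v * y v) - (P x - g x * y v)) + ((P x - g x * y u) - (P u - g u * y u))"
    by (simp add: algebra_simps)
  also have "\<bar>\<dots>\<bar> \<le> G * w * (v - x) + G * w * (x - u)"
    by (rule order_trans[OF abs_triangle_ineq add_mono]) (use uv in \<open>auto intro!: *\<close>)
  finally show ?thesis by (simp add: algebra_simps)
qed

text \<open>\<open>P\<close> stands for a primitive of \<open>g' y\<close>, which keeps this a mean value argument without integrals.\<close>

lemma has_rs_integral_by_parts: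
  fixes g g' y P :: "real \<Rightarrow> real"
  assumes ab: "a \<le> b"
    and dg: "\<And>s. (g has_real_derivative g' s) (at s)"
    and dP: "\<And>s. (P has_real_derivative g' s * y s) (at s)"
    and cg: "continuous_on {a..b} g'" and cy: "continuous_on {a..b} y"
  shows "has_rs_integral g y a b ((g b * y b - P b) - (g a * y a - P a))"
  unfolding has_rs_integral_def
proof (intro allI impI)
  fix e :: real assume e: "e > 0"
  define F where "F s = g s * y s - P s" for s
  obtain G0 where G0: "\<And>s. s \<in> {a..b} \<Longrightarrow> \<bar>g' s\<bar> \<le> G0"
    using compact_imp_bounded[OF compact_continuous_image[OF cg compact_Icc]]
    unfolding bounded_iff by fastforce
  define G where "G = \<bar>G0\<bar> + 1"
  have G: "G > 0" "\<And>s. s \<in> {a..b} \<Longrightarrow> \<bar>g' s\<bar> \<le> G"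
    using order_trans[OF G0, of _ G] by (auto simp: G_def)
  \<comment> \<open>Makes \<open>G * w * (b - a)\<close> smaller than e; the added 1 keeps the
    denominator positive when a = b.\<close>
  define w where "w = e / (2 * G * (b - a + 1))"
  have w: "w > 0" using e G ab by (simp add: w_def)
  have Gw: "G * w * (b - a) < e"
  proof -
    have "G * w * (b - a) = e * ((b - a) / (2 * (b - a + 1)))" using G ab by (simp add: w_def)
    also have "\<dots> < e * 1" using e ab by (intro mult_strict_left_mono) (auto simp: divide_simps)
    finally show ?thesis by simp
  qed
  obtain d where d: "d > 0"
    "\<And>r s. r \<in> {a..b} \<Longrightarrow> s \<in> {a..b} \<Longrightarrow> dist s r < d \<Longrightarrow> dist (y s) (y r) < w"
    using compact_uniformly_continuous[OF cy compact_Icc] w unfolding uniformly_continuous_on_def by meson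
  show "\<exists>d>0. \<forall>D. D tagged_division_of {a..b} \<and> (\<lambda>x. ball x d) fine D \<longrightarrow>
        \<bar>(\<Sum>(x, K)\<in>D. g x * (y (Sup K) - y (Inf K))) - (g b * y b - P b - (g a * y a - P a))\<bar> < e"
  \<comment> \<open>Two points of a cell both lie within d / 2 of its tag, hence within d of each
    other.\<close>
  proof (intro exI[of _ "d / 2"] conjI allI impI)
    show "d / 2 > 0" using d by simp
    fix D assume D: "D tagged_division_of {a..b} \<and> (\<lambda>x. ball x (d / 2)) fine D"
    then have tag: "D tagged_division_of {a..b}" by simp
    have tele: "(\<Sum>(x, K)\<in>D. F (Sup K) - F (Inf K)) = F b - F a"
      "(\<Sum>(x, K)\<in>D. Sup K - Inf K) = b - a"
      using additive_tagged_division_1[OF ab tag, of F] additive_tagged_division_1[OF ab tag, of "\<lambda>x. x"] by auto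
    have loc: "\<bar>g x * (y (Sup K) - y (Inf K)) - (F (Sup K) - F (Inf K))\<bar> \<le> G * w * (Sup K - Inf K)"
      if xK: "(x, K) \<in> D" for x K
    proof -
      obtain u v where K: "K = {u..v}"
        using tagged_division_ofD(4)[OF tag xK] by (metis box_real(2))
      have xK': "x \<in> K" "K \<subseteq> {a..b}" using tagged_division_ofD(2,3)[OF tag xK] by auto
      have uv: "u \<le> x" "x \<le> v" using xK' K by auto
      have Kb: "K \<subseteq> ball x (d / 2)" using D xK unfolding fine_def by blast
      have "\<bar>g x * (y v - y u) - (F v - F u)\<bar> \<le> G * w * (v - u)"
        unfolding F_def
      proof (rule rs_increment_bound[OF uv dg dP])
        show "\<bar>g' s\<bar> \<le> G" if "s \<in> {u..v}" for s using that xK' K G by auto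
        fix r s assume rs: "r \<in> {u..v}" "s \<in> {u..v}"
        then have "dist x r < d / 2" "dist x s < d / 2" using Kb K by (auto simp: subset_iff)
        then have "dist r s < d" by (rule dist_triangle_half_r)
        then have "dist (y r) (y s) < w" using rs xK' K by (intro d(2)) auto
        then show "\<bar>y r - y s\<bar> \<le> w" by (simp add: dist_real_def)
      qed
      moreover have "Sup K = v" "Inf K = u" using uv K by auto
      ultimately show ?thesis by simp
    qed
    have "(\<Sum>(x, K)\<in>D. g x * (y (Sup K) - y (Inf K))) - (F b - F a) =
        (\<Sum>(x, K)\<in>D. g x * (y (Sup K) - y (Inf K)) - (F (Sup K) - F (Inf K)))"
      unfolding tele(1)[symmetric] sum_subtractf[symmetric] by (rule sum.cong) auto
    also have "\<bar>\<dots>\<bar> \<le> (\<Sum>(x, K)\<in>D. G * w * (Sup K - Inf K))"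
      by (rule order_trans[OF sum_abs sum_mono]) (use loc in auto)
    also have "\<dots> = G * w * (b - a)"
      unfolding tele(2)[symmetric] sum_distrib_left by (rule sum.cong) auto
    also note Gw
    finally show "\<bar>(\<Sum>(x, K)\<in>D. g x * (y (Sup K) - y (Inf K))) - (g b * y b - P b - (g a * y a - P a))\<bar> < e"
      by (simp add: F_def)
  qed
qed

text \<open>By Cousin's lemma some tagged division is fine for both radii; its Riemann sum would lie
  closer than half their distance to two different values.\<close>

lemma has_rs_integral_unique:
  assumes "has_rs_integral g y a b v" "has_rs_integral g y a b v'"
  shows "v = v'"
proof (rule ccontr)
  assume "v \<noteq> v'"
  then have e: "\<bar>v - v'\<bar> / 2 > 0" by simp
  obtain d where d: "d > 0" "\<And>D. D tagged_division_of {a..b} \<Longrightarrow> (\<lambda>x. ball x d) fine D \<Longrightarrow>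
      \<bar>(\<Sum>(x, K)\<in>D. g x * (y (Sup K) - y (Inf K))) - v\<bar> < \<bar>v - v'\<bar> / 2"
    using assms(1)[unfolded has_rs_integral_def, rule_format, OF e] by auto
  obtain d' where d': "d' > 0" "\<And>D. D tagged_division_of {a..b} \<Longrightarrow> (\<lambda>x. ball x d') fine D \<Longrightarrow>
      \<bar>(\<Sum>(x, K)\<in>D. g x * (y (Sup K) - y (Inf K))) - v'\<bar> < \<bar>v - v'\<bar> / 2"
    using assms(2)[unfolded has_rs_integral_def, rule_format, OF e] by auto
  have "gauge (\<lambda>x. ball x (min d d'))" using d d' by (intro gauge_ball) auto
  then obtain D where D: "D tagged_division_of {a..b}" "(\<lambda>x. ball x (min d d')) fine D"
    using fine_division_exists_real by blast
  have "(\<lambda>x. ball x d) fine D" "(\<lambda>x. ball x d') fine D"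
    using D(2) by (auto simp: fine_def subset_iff)
  define S where "S = (\<Sum>(x, K)\<in>D. g x * (y (Sup K) - y (Inf K)))"
  have "\<bar>S - v\<bar> < \<bar>v - v'\<bar> / 2" "\<bar>S - v'\<bar> < \<bar>v - v'\<bar> / 2"
    using d(2) d'(2) D(1) \<open>(\<lambda>x. ball x d) fine D\<close> \<open>(\<lambda>x. ball x d') fine D\<close> unfolding S_def by blast+
  then have "\<bar>(S - v') - (S - v)\<bar> < \<bar>v - v'\<bar> / 2 + \<bar>v - v'\<bar> / 2"
    by (intro le_less_trans[OF abs_triangle_ineq4 add_strict_mono])
  then show False by simp
qed

lemma has_improper_rs_integral_unique:
  assumes "has_improper_rs_integral g y t v" "has_improper_rs_integral g y t v'"
  shows "v = v'"
proof -
  obtain I I' where I: "\<And>a. a \<le> t \<Longrightarrow> has_rs_integral g y a t (I a)" "(I \<longlongrightarrow> v) at_bot"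
    and I': "\<And>a. a \<le> t \<Longrightarrow> has_rs_integral g y a t (I' a)" "(I' \<longlongrightarrow> v') at_bot"
    using assms unfolding has_improper_rs_integral_def by blast
  have "\<forall>\<^sub>F a in at_bot. I a = I' a"
    using eventually_le_at_bot[of t] by eventually_elim (rule has_rs_integral_unique[OF I(1) I'(1)])
  then have "(I' \<longlongrightarrow> v) at_bot" using I(2) by (rule Lim_transform_eventually[rotated])
  with I'(2) show ?thesis using tendsto_unique[OF trivial_limit_at_bot_linorder] by blast
qed

text \<open>The differential equation of \<open>expmean l y\<close> says that its product with the
  kernel is a primitive of \<open>l * exp (- l * (t - s)) * y s\<close>, so integration by parts
  produces no further integral. The boundary term vanishes at minus infinity.\<close>

lemma T_op_subcubic:
  assumes y: "subcubic y" and l: "l > 0"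
  shows "T_op l y = (\<lambda>t. y t - expmean l y t)"
proof
  fix t
  let ?g = "\<lambda>s. exp (- l * (t - s))" and ?m = "expmean l y"
  define I where "I a = (y t - ?m t) - (?g a * y a - ?g a * ?m a)" for a
  have rs: "has_rs_integral ?g y a t (I a)" if "a \<le> t" for a
  proof -
    have "has_rs_integral ?g y a t ((?g t * y t - ?g t * ?m t) - (?g a * y a - ?g a * ?m a))"
    proof (rule has_rs_integral_by_parts[where g' = "\<lambda>s. l * ?g s"])
      show "(?g has_real_derivative l * ?g s) (at s)" for s
        by (auto intro!: derivative_eq_intros)
      show "((\<lambda>s. ?g s * ?m s) has_real_derivative l * ?g s * y s) (at s)" for s
        by (auto intro!: derivative_eq_intros expmean_has_derivative y l simp: algebra_simps)
      show "continuous_on {a..t} (\<lambda>s. l * ?g s)" by (intro continuous_intros)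
    qed (use that subcubic_continuous[OF y] in auto)
    then show ?thesis by (simp add: I_def)
  qed
  have "((\<lambda>a. (y t - ?m t) - exp (- l * t) * (exp (l * a) * (y a - ?m a))) \<longlongrightarrow> (y t - ?m t) - exp (- l * t) * 0) at_bot"
    by (intro tendsto_intros subcubic_exp_tendsto_0 subcubic_diff subcubic_expmean y l)
  moreover have "(\<lambda>a. (y t - ?m t) - exp (- l * t) * (exp (l * a) * (y a - ?m a))) = I"
  proof
    fix a
    have "?g a = exp (- l * t) * exp (l * a)" by (simp add: exp_add[symmetric] algebra_simps)
    then show "(y t - ?m t) - exp (- l * t) * (exp (l * a) * (y a - ?m a)) = I a"
      by (simp add: I_def algebra_simps)
  qed
  ultimately have "(I \<longlongrightarrow> y t - ?m t) at_bot" by simp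
  with rs have "has_improper_rs_integral ?g y t (y t - ?m t)"
    unfolding has_improper_rs_integral_def by blast
  then show "T_op l y t = y t - ?m t"
    unfolding T_op_def by (intro the_equality) (auto intro: has_improper_rs_integral_unique)
qed

lemma expmean_sum:
  assumes "\<And>i. i \<in> A \<Longrightarrow> subcubic (y i)" "l > 0"
  shows "expmean l (\<lambda>s. \<Sum>i\<in>A. c i * y i s) t = (\<Sum>i\<in>A. c i * expmean l (y i) t)"
  unfolding expmean_def using assms
  by (subst Bochner_Integration.integral_sum) (auto intro!: integrable_exp_law_subcubic)

lemma subcubic_T_op: "subcubic y \<Longrightarrow> l > 0 \<Longrightarrow> subcubic (T_op l y)"
  by (simp add: T_op_subcubic subcubic_diff subcubic_expmean)

lemma T_op_sum:
  assumes y: "\<And>i. i \<in> A \<Longrightarrow> subcubic (y i)" and l: "l > 0"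
  shows "T_op l (\<lambda>s. \<Sum>i\<in>A. c i * y i s) t = (\<Sum>i\<in>A. c i * T_op l (y i) t)"
proof -
  have "T_op l (\<lambda>s. \<Sum>i\<in>A. c i * y i s) t = (\<Sum>i\<in>A. c i * y i t) - (\<Sum>i\<in>A. c i * expmean l (y i) t)"
    by (subst T_op_subcubic) (auto intro!: subcubic_sum subcubic_cmult y l simp: expmean_sum[OF y l])
  also have "\<dots> = (\<Sum>i\<in>A. c i * T_op l (y i) t)"
    unfolding sum_subtractf[symmetric] by (rule sum.cong) (auto simp: T_op_subcubic y l algebra_simps)
  finally show ?thesis .
qed

text \<open>The right-hand side solves the equation that characterises the exponential mean, of rate
  a, of \<open>expmean b y\<close>.\<close>

lemma expmean_expmean:
  assumes y: "subcubic y" and a: "a > 0" and b: "b > 0" and ab: "a \<noteq> b"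
  shows "expmean a (expmean b y) t = (a * expmean b y t - b * expmean a y t) / (a - b)"
proof -
  have "expmean a (expmean b y) = (\<lambda>t. a / (a - b) * expmean b y t + - b / (a - b) * expmean a y t)"
    (is "_ = ?z")
  proof (rule expmean_unique)
    show "(?z has_real_derivative a * (expmean b y t - ?z t)) (at t)" for t
      by (auto intro!: derivative_eq_intros expmean_has_derivative y a b simp: ab divide_simps)
        (auto simp: algebra_simps)
  qed (intro subcubic_add subcubic_cmult subcubic_expmean y a b)+
  then show ?thesis by (simp add: diff_divide_distrib)
qed

text \<open>Writing each operator as identity minus mean reduces this to
  \<open>expmean_expmean\<close>. A composition becomes a linear combination, which drives the
  induction over the list of rates.\<close>

lemma T_op_T_op:
  assumes y: "subcubic y" and a: "a > 0" and b: "b > 0" and ab: "a \<noteq> b"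
  shows "T_op a (T_op b y) t = (a * T_op a y t - b * T_op b y t) / (a - b)"
proof -
  have m: "expmean a (\<lambda>t. y t - expmean b y t) t = expmean a y t - expmean a (expmean b y) t"
    unfolding expmean_def[of a] 
    by (intro Bochner_Integration.integral_diff integrable_exp_law_subcubic subcubic_expmean y a b)
  have "T_op a (T_op b y) t = y t - expmean b y t - (expmean a y t - expmean a (expmean b y) t)"
    using T_op_subcubic[OF subcubic_T_op[OF y b] a] by (simp add: T_op_subcubic[OF y b] m)
  also have "\<dots> = (a * T_op a y t - b * T_op b y t) / (a - b)"
    using ab by (simp add: T_op_subcubic[OF y a] T_op_subcubic[OF y b] expmean_expmean[OF y a b ab] field_simps)
  finally show ?thesis .
qed

section \<open>Partial fractions and the composed operator\<close>

text \<open>With \<open>S\<close> the set of all \<open>\<lambda>\<^sub>j\<close> and \<open>a = \<lambda>\<^sub>i\<close> this is the coefficient \<open>K\<^sub>i\<close> of the paper.\<close>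

definition pf_coeff :: "real set \<Rightarrow> real \<Rightarrow> real" where
  "pf_coeff S a = (\<Prod>b\<in>S - {a}. a / (a - b))"

lemma pf_coeff_insert:
  assumes "finite S" "b \<notin> S" "a \<in> S"
  shows "pf_coeff (insert b S) a = a / (a - b) * pf_coeff S a"
proof -
  have "insert b S - {a} = insert b (S - {a})" using assms by auto
  then show ?thesis using assms by (simp add: pf_coeff_def)
qed

lemma minus_divide_minus_add: "- b / (- b + a) = b / (b - a)" for a b :: real
  by (metis minus_diff_eq minus_divide_divide uminus_add_conv_diff)

text \<open>Induction on the set of poles. The coefficient of a new pole b is the induction
  hypothesis evaluated at x = -b; the identity for two poles, applied term by term, then absorbs the
  factor \<open>x / (x + b)\<close>.\<close>

lemma partial_fractions:
  assumes "finite S" "S \<noteq> {}" "\<And>a. a \<in> S \<Longrightarrow> x + a \<noteq> 0"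
    and "\<And>a. a \<in> S \<Longrightarrow> a > 0"
  shows "(\<Sum>a\<in>S. pf_coeff S a * (x / (x + a))) = (\<Prod>a\<in>S. x / (x + a))"
  using assms
proof (induction S arbitrary: x rule: finite_ne_induct)
  case (singleton a)
  then show ?case by (simp add: pf_coeff_def)
next
  case (insert b S)
  have nz: "x + a \<noteq> 0" "a > 0" "a \<noteq> b" if "a \<in> S" for a using insert that by auto
  have "(\<Sum>a\<in>S. pf_coeff S a * (- b / (- b + a))) = (\<Prod>a\<in>S. - b / (- b + a))"
    using insert by (intro insert.IH) auto
  also have "\<dots> = (\<Prod>a\<in>S. b / (b - a))"
    by (simp only: minus_divide_minus_add)
  also have "\<dots> = pf_coeff (insert b S) b" using insert by (simp add: pf_coeff_def)
  finally have b: "pf_coeff (insert b S) b = (\<Sum>a\<in>S. pf_coeff S a * (- b / (- b + a)))" ..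
  have "(\<Sum>a\<in>insert b S. pf_coeff (insert b S) a * (x / (x + a)))
      = (\<Sum>a\<in>S. pf_coeff S a * (- b / (- b + a))) * (x / (x + b)) + (\<Sum>a\<in>S. a / (a - b) * pf_coeff S a * (x / (x + a)))"
    using insert by (subst sum.insert) (auto simp: b pf_coeff_insert)
  also have "\<dots> = (\<Sum>a\<in>S. x / (x + b) * (pf_coeff S a * (x / (x + a))))"
    unfolding sum_distrib_right sum.distrib[symmetric]
  proof (rule sum.cong[OF refl])
    fix a assume a: "a \<in> S"
    have "- b / (- b + a) * (x / (x + b)) + a / (a - b) * (x / (x + a)) = x / (x + b) * (x / (x + a))"
      using nz[OF a] insert.prems(1)[of b] by (simp add: divide_simps) (simp add: algebra_simps)
    then show "pf_coeff S a * (- b / (- b + a)) * (x / (x + b)) + a / (a - b) * pf_coeff S a * (x / (x + a)) =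
      x / (x + b) * (pf_coeff S a * (x / (x + a)))"
      by (metis (no_types, opaque_lifting) distrib_left mult.assoc mult.left_commute)
  qed
  also have "\<dots> = x / (x + b) * (\<Prod>a\<in>S. x / (x + a))"
    unfolding sum_distrib_left[symmetric] using insert by (subst insert.IH) auto
  finally show ?case using insert by simp
qed

text \<open>Prepending b turns every \<open>T_op a y\<close> into \<open>T_op b (T_op a y)\<close>,
  which \<open>T_op_T_op\<close> splits. The multiples of \<open>T_op b y\<close> collect to a
  partial fraction sum at x = -b, which is the coefficient of the new rate.\<close>

lemma foldr_T_op:
  assumes y: "subcubic y" and "xs \<noteq> []" "distinct xs" "\<And>a. a \<in> set xs \<Longrightarrow> a > 0"
  shows "foldr T_op xs y = (\<lambda>t. \<Sum>a\<in>set xs. pf_coeff (set xs) a * T_op a y t)"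
  using assms(2-)
proof (induction xs rule: list_nonempty_induct)
  case (single a)
  then show ?case by (simp add: pf_coeff_def)
next
  case (cons b xs)
  let ?S = "set xs"
  have nz: "a > 0" "a \<noteq> b" if "a \<in> ?S" for a using cons that by auto
  have b: "b > 0" "b \<notin> ?S" using cons by auto
  have K: "(\<Sum>a\<in>?S. pf_coeff ?S a * (b / (b - a))) = pf_coeff (insert b ?S) b"
  proof -
    have "(\<Sum>a\<in>?S. pf_coeff ?S a * (- b / (- b + a))) = (\<Prod>a\<in>?S. - b / (- b + a))"
      using nz cons by (intro partial_fractions) force+
    then show ?thesis unfolding minus_divide_minus_add using b by (simp add: pf_coeff_def)
  qed
  show ?case
  proof
    fix t
    have "foldr T_op (b # xs) y t = (\<Sum>a\<in>?S. pf_coeff ?S a * T_op b (T_op a y) t)"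
      using cons nz b by (simp add: T_op_sum subcubic_T_op y)
    also have "\<dots> = (\<Sum>a\<in>?S. pf_coeff ?S a * (b / (b - a))* T_op b y t + a / (a - b) * pf_coeff ?S a * T_op a y t)"
    proof (rule sum.cong[OF refl])
      fix a assume a: "a \<in> ?S"
      show "pf_coeff ?S a * T_op b (T_op a y) t =
          pf_coeff ?S a * (b / (b - a))* T_op b y t + a / (a - b) * pf_coeff ?S a * T_op a y t"
        using nz[OF a] b by (subst T_op_T_op[OF y]) (auto simp: divide_simps, auto simp: algebra_simps)
    qed
    also have "\<dots> = pf_coeff (insert b ?S) b * T_op b y t + (\<Sum>a\<in>?S. a / (a - b) * pf_coeff ?S a * T_op a y t)"
      unfolding sum.distrib K[symmetric] sum_distrib_right ..
    also have "\<dots> = (\<Sum>a\<in>set (b # xs). pf_coeff (set (b # xs)) a * T_op a y t)"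
      using b by (simp add: pf_coeff_insert)
    finally show "foldr T_op (b # xs) y t = (\<Sum>a\<in>set (b # xs). pf_coeff (set (b # xs)) a * T_op a y t)" .
  qed
qed

section \<open>Growth of fractional Brownian paths\<close>

text \<open>A dyadic point of level k is reached from a by at most one increment per level, since an
  even index already belongs to the coarser level; the total is bounded by a geometric series.
  Continuity extends the bound to all x.\<close>

lemma dyadic_chaining:
  fixes y :: "real \<Rightarrow> real"
  assumes cont: "continuous_on {a..a+1} y" and r: "0 \<le> r" "r < 1" and K: "K \<ge> 0"
    and inc: "\<And>k j. j < 2 ^ k \<Longrightarrow> \<bar>y (a + real (Suc j) / 2 ^ k) - y (a + real j / 2 ^ k)\<bar> \<le> K * r ^ k"
    and x: "x \<in> {a..a+1}"
  shows "\<bar>y x - y a\<bar> \<le> K / (1 - r)"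
proof -
  have dyadic: "\<bar>y (a + real j / 2 ^ k) - y a\<bar> \<le> K * (\<Sum>i\<le>k. r ^ i)" if "j \<le> 2 ^ k" for k j
    using that
  proof (induction k arbitrary: j)
    case 0
    then have "j = 0 \<or> j = 1" by auto
    then show ?case using inc[of 0 0] K by auto
  next
    case (Suc k)
    have even: "\<bar>y (a + real j / 2 ^ Suc k) - y a\<bar> \<le> K * (\<Sum>i\<le>k. r ^ i)" if "even j" "j \<le> 2 ^ Suc k" for j
    proof -
      obtain m where m: "j = 2 * m" using \<open>even j\<close> by blast
      then show ?thesis using Suc.IH[of m] that by simp
    qed
    have rk: "K * r ^ Suc k \<ge> 0" using K r by simp
    show ?case
    proof (cases "even j")
      case True
      then show ?thesis using even[OF True Suc.prems] rk by (simp add: distrib_left)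
    next
      case False
      then obtain m where m: "j = Suc (2 * m)" using oddE by fastforce
      have "\<bar>y (a + real (2 * m) / 2 ^ Suc k) - y a\<bar> \<le> K * (\<Sum>i\<le>k. r ^ i)"
        using m Suc.prems by (intro even) auto
      moreover have "\<bar>y (a + real j / 2 ^ Suc k) - y (a + real (2 * m) / 2 ^ Suc k)\<bar> \<le> K * r ^ Suc k"
        using inc[of "2 * m" "Suc k"] m Suc.prems by simp
      ultimately have "\<bar>y (a + real j / 2 ^ Suc k) - y a\<bar> \<le> K * (\<Sum>i\<le>k. r ^ i) + K * r ^ Suc k"
        by linarith
      then show ?thesis by (simp add: distrib_left)
    qed
  qed
  have bound: "\<bar>y (a + real j / 2 ^ k) - y a\<bar> \<le> K / (1 - r)" if "j \<le> 2 ^ k" for k j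
  proof -
    have "(\<Sum>i\<le>k. r ^ i) \<le> (\<Sum>i. r ^ i)"
      using r by (intro sum_le_suminf summable_geometric) auto
    also have "\<dots> = 1 / (1 - r)" using r by (intro suminf_geometric) auto
    finally have "K * (\<Sum>i\<le>k. r ^ i) \<le> K * (1 / (1 - r))" using K by (rule mult_left_mono)
    with dyadic[OF that] show ?thesis by simp
  qed
  \<comment> \<open>Indexes the last dyadic point of level k not beyond x, so the approximants stay
    in the interval and converge to x.\<close>
  define j where "j k = nat \<lfloor>(x - a) * 2 ^ k\<rfloor>" for k :: nat
  have jle: "j k \<le> 2 ^ k" for k
  proof -
    have "(x - a) * 2 ^ k \<le> 1 * 2 ^ k" using x by (intro mult_right_mono) auto
    then have "\<lfloor>(x - a) * 2 ^ k\<rfloor> \<le> 2 ^ k" using floor_mono[of _ "2 ^ k :: real"] by fastforce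
    then show ?thesis by (simp add: j_def nat_le_iff)
  qed
  have jx: "a + real (j k) / 2 ^ k \<le> x" "x - (1/2) ^ k \<le> a + real (j k) / 2 ^ k" for k
  proof -
    have "real (j k) = of_int \<lfloor>(x - a) * 2 ^ k\<rfloor>" using x by (simp add: j_def)
    then have "real (j k) \<le> (x - a) * 2 ^ k" "(x - a) * 2 ^ k - 1 \<le> real (j k)" by linarith+
    then show "a + real (j k) / 2 ^ k \<le> x" "x - (1/2) ^ k \<le> a + real (j k) / 2 ^ k"
      using divide_right_mono[of "(x - a) * 2 ^ k - 1" "real (j k)" "2 ^ k"]
        divide_right_mono[of "real (j k)" "(x - a) * 2 ^ k" "2 ^ k"]
      by (simp_all add: diff_divide_distrib power_one_over)
  qed
  have "(\<lambda>k. (1/2::real) ^ k) \<longlonglongrightarrow> 0" by (rule LIMSEQ_realpow_zero) auto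
  then have lim0: "(\<lambda>k. x - (1/2) ^ k) \<longlonglongrightarrow> x - 0" by (rule tendsto_diff[OF tendsto_const])
  have lim: "(\<lambda>k. a + real (j k) / 2 ^ k) \<longlonglongrightarrow> x"
    by (rule tendsto_sandwich[of "\<lambda>k. x - (1/2) ^ k" _ _ "\<lambda>k. x"])
      (use lim0 in \<open>auto intro!: always_eventually jx\<close>)
  have "(\<lambda>k. y (a + real (j k) / 2 ^ k)) \<longlonglongrightarrow> y x"
    using lim x jle by (intro continuous_on_tendsto_compose[OF cont]) auto
  then have "(\<lambda>k. \<bar>y (a + real (j k) / 2 ^ k) - y a\<bar>) \<longlonglongrightarrow> \<bar>y x - y a\<bar>" by (intro tendsto_intros)
  then show ?thesis
    by (rule tendsto_upperbound) (use bound jle in auto)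
qed

text \<open>Summing about t unit steps, each of size at most a multiple of
  \<open>(1 + t) ^ 2\<close>, costs one more power.\<close>

lemma cubic_growth_of_oscillation:
  fixes y :: "real \<Rightarrow> real"
  assumes osc: "\<And>n x. x \<in> {real n..real n + 1} \<Longrightarrow> \<bar>y x - y (real n)\<bar> \<le> K * (real n + 1) ^ 2"
    and K: "K \<ge> 0" and t: "t \<ge> 0"
  shows "\<bar>y t\<bar> \<le> (\<bar>y 0\<bar> + 2 * K) * (1 + t) ^ 3"
proof -
  have nat: "\<bar>y (real n)\<bar> \<le> \<bar>y 0\<bar> + K * real n * (real n + 1) ^ 2" for n
  proof (induction n)
    case (Suc n)
    have "\<bar>y (real (Suc n)) - y (real n)\<bar> \<le> K * (real n + 1) ^ 2"
      by (rule osc) auto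
    then have "\<bar>y (real (Suc n))\<bar> \<le> \<bar>y 0\<bar> + K * real n * (real n + 1) ^ 2 + K * (real n + 1) ^ 2"
      using Suc by linarith
    also have "\<dots> = \<bar>y 0\<bar> + K * real (Suc n) * (real n + 1) ^ 2" by (simp add: algebra_simps)
    also have "\<dots> \<le> \<bar>y 0\<bar> + K * real (Suc n) * (real (Suc n) + 1) ^ 2"
      using K by (intro add_left_mono mult_left_mono power_mono) auto
    finally show ?case .
  qed simp
  define n where "n = nat \<lfloor>t\<rfloor>"
  have n: "real n \<le> t" "t \<le> real n + 1" using t unfolding n_def by linarith+
  have "\<bar>y t\<bar> \<le> \<bar>y (real n)\<bar> + K * (real n + 1) ^ 2" using osc[of t n] n by auto
  also have "\<dots> \<le> \<bar>y 0\<bar> + K * real n * (real n + 1) ^ 2 + K * (real n + 1) ^ 2" using nat[of n] by simp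
  also have "\<dots> = \<bar>y 0\<bar> + K * (real n + 1) ^ 3" by (simp add: power2_eq_square power3_eq_cube algebra_simps)
  also have "\<dots> \<le> \<bar>y 0\<bar> * (1 + t) ^ 3 + K * (1 + t) ^ 3"
  proof (rule add_mono)
    show "K * (real n + 1) ^ 3 \<le> K * (1 + t) ^ 3" using n K by (intro mult_left_mono power_mono) auto
    have "\<bar>y 0\<bar> * 1 \<le> \<bar>y 0\<bar> * (1 + t) ^ 3" using t by (intro mult_left_mono one_le_power) auto
    then show "\<bar>y 0\<bar> \<le> \<bar>y 0\<bar> * (1 + t) ^ 3" by simp
  qed
  also have "\<dots> \<le> (\<bar>y 0\<bar> + 2 * K) * (1 + t) ^ 3" using K t by (simp add: distrib_right)
  finally show ?thesis .
qed

text \<open>The Kolmogorov-type moment sum: \<open>Y n k\<close> will be the sum of the \<open>m\<close>-th powers of the dyadic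
  increments of level \<open>k\<close> over \<open>[n, n + 1]\<close>. Finiteness of its weighted sum replaces Borel--Cantelli.\<close>

lemma AE_bounded_of_moments:
  fixes Y :: "nat \<Rightarrow> nat \<Rightarrow> 'a \<Rightarrow> real"
  assumes [measurable]: "\<And>n k. Y n k \<in> borel_measurable M"
    and nonneg: "\<And>n k \<omega>. Y n k \<omega> \<ge> 0"
    and int: "\<And>n k. (\<integral>\<^sup>+\<omega>. ennreal (Y n k \<omega>) \<partial>M) \<le> ennreal (c * (1/4) ^ k)"
  shows "AE \<omega> in M. \<exists>S\<ge>0. \<forall>n k. Y n k \<omega> \<le> S * (real n + 1) ^ 2 * (1/2) ^ k"
proof -
  \<comment> \<open>The factor \<open>2 ^ k\<close> reduces the moment bound to
    \<open>(1/2) ^ k\<close>, and \<open>1 / (n + 1)^2\<close> is summable, so the double series has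
    finite expectation.\<close>
  define W where "W n k \<omega> = Y n k \<omega> * 2 ^ k * (1 / (real n + 1) ^ 2)" for n k \<omega>
  have [measurable]: "W n k \<in> borel_measurable M" for n k unfolding W_def by measurable
  have Wn: "W n k \<omega> \<ge> 0" for n k \<omega> using nonneg by (simp add: W_def)
  define b where "b n = 1 / (real n + 1) ^ 2" for n
  have "summable (\<lambda>n. 1 / (real (Suc n)) ^ 2)"
    using inverse_power_summable[of 2, where 'a = real] summable_Suc_iff[of "\<lambda>n. inverse (real n ^ 2)"]
    by (simp add: inverse_eq_divide)
  then have b: "summable b" "\<And>n. b n \<ge> 0" by (simp_all add: b_def[abs_def] add.commute)
  have W_int: "(\<integral>\<^sup>+\<omega>. ennreal (W n k \<omega>) \<partial>M) \<le> ennreal (\<bar>c\<bar> * b n * (1/2) ^ k)" for n k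
  proof -
    have "(\<integral>\<^sup>+\<omega>. ennreal (W n k \<omega>) \<partial>M) = (\<integral>\<^sup>+\<omega>. ennreal (2 ^ k * b n) * ennreal (Y n k \<omega>) \<partial>M)"
      using nonneg b(2) by (simp add: W_def b_def ennreal_mult'[symmetric] ac_simps)
    also have "\<dots> = ennreal (2 ^ k * b n) * (\<integral>\<^sup>+\<omega>. ennreal (Y n k \<omega>) \<partial>M)"
      by (rule nn_integral_cmult) simp
    also have "\<dots> \<le> ennreal (2 ^ k * b n) * ennreal (\<bar>c\<bar> * (1/4) ^ k)"
      by (intro mult_left_mono order_trans[OF int] ennreal_leI mult_right_mono) auto
    also have "\<dots> = ennreal (2 ^ k * b n * (\<bar>c\<bar> * (1/4) ^ k))"
      using b(2) by (simp add: ennreal_mult'[symmetric])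
    also have "2 ^ k * b n * (\<bar>c\<bar> * (1/4) ^ k) = \<bar>c\<bar> * b n * (2 * (1/4)) ^ k"
      unfolding power_mult_distrib by simp
    finally show ?thesis by simp
  qed
  have "(\<integral>\<^sup>+\<omega>. (\<Sum>n. \<Sum>k. ennreal (W n k \<omega>)) \<partial>M) = (\<Sum>n. \<Sum>k. \<integral>\<^sup>+\<omega>. ennreal (W n k \<omega>) \<partial>M)"
    by (simp add: nn_integral_suminf)
  also have "\<dots> \<le> (\<Sum>n. \<Sum>k. ennreal (\<bar>c\<bar> * b n * (1/2) ^ k))"
    by (intro suminf_le W_int) auto
  also have "\<dots> = (\<Sum>n. ennreal (\<bar>c\<bar> * b n * 2))"
  proof (rule suminf_cong)
    fix n
    have "(\<lambda>k. \<bar>c\<bar> * b n * (1/2) ^ k) sums (\<bar>c\<bar> * b n * (1 / (1 - 1/2)))"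
      by (intro sums_mult geometric_sums) auto
    then have "(\<lambda>k. \<bar>c\<bar> * b n * (1/2) ^ k) sums (\<bar>c\<bar> * b n * 2)" by simp
    then show "(\<Sum>k. ennreal (\<bar>c\<bar> * b n * (1/2) ^ k)) = ennreal (\<bar>c\<bar> * b n * 2)"
      using b(2) by (subst suminf_ennreal2) (auto simp: sums_iff)
  qed
  also have "\<dots> = ennreal (\<Sum>n. \<bar>c\<bar> * b n * 2)"
    using b by (intro suminf_ennreal2) (auto intro: summable_mult2 summable_mult)
  also have "\<dots> < \<infinity>" by simp
  finally have "AE \<omega> in M. (\<Sum>n. \<Sum>k. ennreal (W n k \<omega>)) \<noteq> \<infinity>"
    by (intro nn_integral_PInf_AE) auto
  then show ?thesis
  proof eventually_elim
    case (elim \<omega>)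
    \<comment> \<open>The total of the series is one random constant that dominates every
      term.\<close>
    define S where "S = enn2real (\<Sum>n. \<Sum>k. ennreal (W n k \<omega>))"
    have S: "ennreal S = (\<Sum>n. \<Sum>k. ennreal (W n k \<omega>))" "S \<ge> 0" using elim by (auto simp: S_def less_top)
    have "Y n k \<omega> \<le> S * (real n + 1) ^ 2 * (1/2) ^ k" for n k
    proof -
      have "ennreal (W n k \<omega>) \<le> (\<Sum>k. ennreal (W n k \<omega>))"
        using sum_le_suminf[of "\<lambda>k. ennreal (W n k \<omega>)" "{k}"] by simp
      also have "\<dots> \<le> (\<Sum>n. \<Sum>k. ennreal (W n k \<omega>))"
        using sum_le_suminf[of "\<lambda>n. \<Sum>k. ennreal (W n k \<omega>)" "{n}"] by simp
      finally have "W n k \<omega> \<le> S" using S Wn by (metis ennreal_le_iff)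
      then show ?thesis by (simp add: W_def power_one_over field_simps)
    qed
    with S(2) show ?case by blast
  qed
qed

text \<open>Level k has \<open>2 ^ k\<close> increments whose m-th moments are at most
  \<open>c * (1/8) ^ k\<close>, so their sum has mean at most \<open>c * (1/4) ^ k\<close>; this is
  where the exponent 3 enters. An m-th root of the almost sure bound gives increments decaying
  geometrically in k, and chaining applies on each unit interval.\<close>

lemma (in prob_space) AE_cubic_growth_half_line:
  fixes Y :: "real \<Rightarrow> 'a \<Rightarrow> real"
  assumes [measurable]: "\<And>t. Y t \<in> borel_measurable M"
    and cont: "AE \<omega> in M. continuous_on UNIV (\<lambda>t. Y t \<omega>)"
    and m: "m > 0" "even m" and c: "c \<ge> 0"
    and mom: "\<And>s t. \<bar>t - s\<bar> \<le> 1 \<Longrightarrow> (\<integral>\<^sup>+\<omega>. ennreal ((Y t \<omega> - Y s \<omega>) ^ m) \<partial>M) \<le> ennreal (c * \<bar>t - s\<bar> ^ 3)"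
  shows "AE \<omega> in M. \<exists>C. \<forall>t\<ge>0. \<bar>Y t \<omega>\<bar> \<le> C * (1 + t) ^ 3"
proof -
  define p where "p n k j = real n + real j / 2 ^ k" for n k j :: nat
  define D where "D n k \<omega> = (\<Sum>j<2 ^ k. (Y (p n k (Suc j)) \<omega> - Y (p n k j) \<omega>) ^ m)" for n k \<omega>
  have "AE \<omega> in M. \<exists>S\<ge>0. \<forall>n k. D n k \<omega> \<le> S * (real n + 1) ^ 2 * (1/2) ^ k"
  proof (rule AE_bounded_of_moments)
    show "D n k \<in> borel_measurable M" for n k unfolding D_def by measurable
    show "D n k \<omega> \<ge> 0" for n k \<omega> unfolding D_def using m by (intro sum_nonneg zero_le_even_power) auto
    fix n k
    have "(\<integral>\<^sup>+\<omega>. ennreal (D n k \<omega>) \<partial>M)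
        = (\<Sum>j<2 ^ k. \<integral>\<^sup>+\<omega>. ennreal ((Y (p n k (Suc j)) \<omega> - Y (p n k j) \<omega>) ^ m) \<partial>M)"
      unfolding D_def using m by (subst nn_integral_sum[symmetric]) (auto simp: sum_ennreal zero_le_even_power)
    also have "\<dots> \<le> (\<Sum>j<(2::nat) ^ k. ennreal (c * (1 / 2 ^ k) ^ 3))"
    proof (rule sum_mono)
      fix j
      have pd: "p n k (Suc j) - p n k j = 1 / 2 ^ k" by (simp add: p_def field_simps)
      have "\<bar>p n k (Suc j) - p n k j\<bar> \<le> 1" unfolding pd by simp
      from mom[OF this] show "(\<integral>\<^sup>+\<omega>. ennreal ((Y (p n k (Suc j)) \<omega> - Y (p n k j) \<omega>) ^ m) \<partial>M) \<le> ennreal (c * (1 / 2 ^ k) ^ 3)"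
        unfolding pd by simp
    qed
    also have "\<dots> = ennreal (c * (1/4) ^ k)"
    proof -
      have "(2::real) ^ k * (c * (1 / 2 ^ k) ^ 3) = c * (1/4) ^ k"
      proof -
        have "(4::real) ^ k = 2 ^ k * 2 ^ k" by (simp add: power_mult_distrib[symmetric])
        then show ?thesis by (simp add: power3_eq_cube power_one_over)
      qed
      then show ?thesis using c by (simp add: ennreal_mult'[symmetric] ennreal_of_nat_eq_real_of_nat)
    qed
    finally show "(\<integral>\<^sup>+\<omega>. ennreal (D n k \<omega>) \<partial>M) \<le> ennreal (c * (1/4) ^ k)" .
  qed
  then show ?thesis using cont
  proof eventually_elim
    case (elim \<omega>)
    then obtain S where S: "S \<ge> 0" "\<And>n k. D n k \<omega> \<le> S * (real n + 1) ^ 2 * (1/2) ^ k" by blast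
    define r :: real where "r = root m (1/2)"
    have r: "0 \<le> r" "r < 1" "r ^ m = 1/2" using m by (auto simp: r_def)
    \<comment> \<open>With K \<ge> 1 the bound \<open>S \<le> K ^ m\<close> avoids an m-th root of
      S; \<open>(n + 1)^2\<close> is enlarged to its m-th power for the same reason.\<close>
    define K where "K = S + 1"
    have K: "K \<ge> 1" "S \<le> K ^ m"
    proof -
      show "K \<ge> 1" using S by (simp add: K_def)
      then have "K ^ 1 \<le> K ^ m" using m by (intro power_increasing) auto
      then show "S \<le> K ^ m" by (simp add: K_def)
    qed
    have inc: "\<bar>Y (p n k (Suc j)) \<omega> - Y (p n k j) \<omega>\<bar> \<le> (K * (real n + 1) ^ 2) * r ^ k" if j: "j < 2 ^ k" for n k j
    proof -
      let ?d = "Y (p n k (Suc j)) \<omega> - Y (p n k j) \<omega>"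
      have "\<bar>?d\<bar> ^ m = ?d ^ m" using m by (simp add: power_even_abs)
      also have "\<dots> \<le> D n k \<omega>" unfolding D_def
        using m j by (intro member_le_sum) (auto intro: zero_le_even_power)
      also have "\<dots> \<le> S * (real n + 1) ^ 2 * (1/2) ^ k" by (rule S)
      also have "\<dots> \<le> K ^ m * ((real n + 1) ^ 2) ^ m * (r ^ m) ^ k"
        unfolding r(3)
      proof (intro mult_mono K)
        have "((real n + 1) ^ 2) ^ 1 \<le> ((real n + 1) ^ 2) ^ m" using m by (intro power_increasing) auto
        then show "(real n + 1) ^ 2 \<le> ((real n + 1) ^ 2) ^ m" by simp
      qed (use r K in auto)
      also have "\<dots> = ((K * (real n + 1) ^ 2) * r ^ k) ^ m"
        by (simp add: power_mult_distrib power_mult[symmetric] mult.commute)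
      finally show ?thesis
        by (rule power_le_imp_le_base[of _ "m - 1", unfolded Suc_diff_1[OF m(1)]]) (use K r in auto)
    qed
    have osc: "\<bar>Y x \<omega> - Y (real n) \<omega>\<bar> \<le> (K / (1 - r)) * (real n + 1) ^ 2" if "x \<in> {real n..real n + 1}" for n x
    proof -
      have "\<bar>Y x \<omega> - Y (real n) \<omega>\<bar> \<le> (K * (real n + 1) ^ 2) / (1 - r)"
        using inc[unfolded p_def] r K that
        by (intro dyadic_chaining[where y = "\<lambda>t. Y t \<omega>"]) (auto intro: continuous_on_subset[OF elim(2)])
      then show ?thesis by simp
    qed
    have "\<bar>Y t \<omega>\<bar> \<le> (\<bar>Y 0 \<omega>\<bar> + 2 * (K / (1 - r))) * (1 + t) ^ 3" if "t \<ge> 0" for t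
      using osc that r K by (intro cubic_growth_of_oscillation[where y = "\<lambda>t. Y t \<omega>"]) auto
    then show ?case by blast
  qed
qed

text \<open>The time-reversed process satisfies the same moment bound, so the half-line result
  covers negative times; the larger constant serves both.\<close>

lemma (in prob_space) AE_subcubic_of_moments:
  fixes Y :: "real \<Rightarrow> 'a \<Rightarrow> real"
  assumes Y: "\<And>t. Y t \<in> borel_measurable M"
    and cont: "AE \<omega> in M. continuous_on UNIV (\<lambda>t. Y t \<omega>)"
    and m: "m > 0" "even m" and c: "c \<ge> 0"
    and mom: "\<And>s t. \<bar>t - s\<bar> \<le> 1 \<Longrightarrow> (\<integral>\<^sup>+\<omega>. ennreal ((Y t \<omega> - Y s \<omega>) ^ m) \<partial>M) \<le> ennreal (c * \<bar>t - s\<bar> ^ 3)"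
  shows "AE \<omega> in M. subcubic (\<lambda>t. Y t \<omega>)"
proof -
  have pos: "AE \<omega> in M. \<exists>C. \<forall>t\<ge>0. \<bar>Y t \<omega>\<bar> \<le> C * (1 + t) ^ 3"
    by (rule AE_cubic_growth_half_line[OF Y cont m c mom])
  have neg: "AE \<omega> in M. \<exists>C. \<forall>t\<ge>0. \<bar>Y (- t) \<omega>\<bar> \<le> C * (1 + t) ^ 3"
  proof (rule AE_cubic_growth_half_line[OF Y _ m c])
    show "AE \<omega> in M. continuous_on UNIV (\<lambda>t. Y (- t) \<omega>)"
      using cont
    proof eventually_elim
      case (elim \<omega>)
      then show ?case
        by (rule continuous_on_compose2) (auto intro!: continuous_intros)
    qed
    show "(\<integral>\<^sup>+\<omega>. ennreal ((Y (- t) \<omega> - Y (- s) \<omega>) ^ m) \<partial>M) \<le> ennreal (c * \<bar>t - s\<bar> ^ 3)"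
      if "\<bar>t - s\<bar> \<le> 1" for s t
      using mom[of "- t" "- s"] that by (simp add: abs_minus_commute)
  qed
  show ?thesis using pos neg cont
  proof eventually_elim
    case (elim \<omega>)
    obtain C where C: "\<And>t. t \<ge> 0 \<Longrightarrow> \<bar>Y t \<omega>\<bar> \<le> C * (1 + t) ^ 3" using elim(1) by blast
    obtain C' where C': "\<And>t. t \<ge> 0 \<Longrightarrow> \<bar>Y (- t) \<omega>\<bar> \<le> C' * (1 + t) ^ 3" using elim(2) by blast
    show ?case
    proof (rule subcubicI[OF elim(3)])
      fix s
      have "\<bar>Y s \<omega>\<bar> \<le> C * (1 + \<bar>s\<bar>) ^ 3 \<or> \<bar>Y s \<omega>\<bar> \<le> C' * (1 + \<bar>s\<bar>) ^ 3"
        using C[of s] C'[of "- s"] by (cases "s \<ge> 0") auto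
      moreover have "C * (1 + \<bar>s\<bar>) ^ 3 \<le> max C C' * (1 + \<bar>s\<bar>) ^ 3" "C' * (1 + \<bar>s\<bar>) ^ 3 \<le> max C C' * (1 + \<bar>s\<bar>) ^ 3"
        by (auto intro!: mult_right_mono)
      ultimately show "\<bar>Y s \<omega>\<bar> \<le> max C C' * (1 + \<bar>s\<bar>) ^ 3" by linarith
    qed
  qed
qed

section \<open>Even moments of centered Gaussian laws\<close>

text \<open>The factor is the double factorial (2q - 1)!!. Expressing the moment through the second
  one eliminates the standard deviation and includes the degenerate law, which centering forces to
  sit at 0.\<close>

lemma gaussian_law_moments:
  assumes "prob_space M" and [measurable]: "Z \<in> borel_measurable M"
    and g: "gaussian_law (distr M borel Z)" and mean: "(\<integral>\<omega>. Z \<omega> \<partial>M) = 0"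
  shows "integrable M (\<lambda>\<omega>. Z \<omega> ^ (2 * q))"
    and "(\<integral>\<omega>. Z \<omega> ^ (2 * q) \<partial>M) = fact (2 * q) / (2 ^ q * fact q) * (\<integral>\<omega>. (Z \<omega>)\<^sup>2 \<partial>M) ^ q"
proof -
  have tr: "integrable M (\<lambda>\<omega>. f (Z \<omega>)) \<longleftrightarrow> integrable (distr M borel Z) f"
    "(\<integral>\<omega>. f (Z \<omega>) \<partial>M) = (\<integral>x. f x \<partial>distr M borel Z)"
    if "f \<in> borel_measurable borel" for f :: "real \<Rightarrow> real"
    using that by (auto simp: integrable_distr_eq integral_distr)
  have "integrable M (\<lambda>\<omega>. Z \<omega> ^ (2 * q)) \<and>
    (\<integral>\<omega>. Z \<omega> ^ (2 * q) \<partial>M) = fact (2 * q) / (2 ^ q * fact q) * (\<integral>\<omega>. (Z \<omega>)\<^sup>2 \<partial>M) ^ q"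
    using g unfolding gaussian_law_def
  proof (elim disjE exE conjE)
    fix \<mu> assume D: "distr M borel Z = return borel \<mu>"
    have "\<mu> = 0" using tr(2)[of "\<lambda>x. x"] mean by (simp add: D integral_return)
    then show ?thesis
      by (subst (1) tr(1), simp, subst (1 2) tr(2)[of "\<lambda>x. x ^ _"])
        (auto simp: D integral_return integrable_iff_bounded nn_integral_return zero_power2 power_0_left)
  next
    fix \<mu> s :: real assume s: "s > 0" and D: "distr M borel Z = density lborel (\<lambda>x. ennreal (normal_density \<mu> s x))"
    have d: "integrable M (\<lambda>\<omega>. f (Z \<omega>)) \<longleftrightarrow> integrable lborel (\<lambda>x. normal_density \<mu> s x * f x)"
      "(\<integral>\<omega>. f (Z \<omega>) \<partial>M) = (\<integral>x. normal_density \<mu> s x * f x \<partial>lborel)"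
      if "f \<in> borel_measurable borel" for f :: "real \<Rightarrow> real"
      using that by (simp_all add: tr D integrable_density integral_density)
    have mu: "\<mu> = 0" using d(2)[of "\<lambda>x. x"] mean integral_normal_moment_nz_1[OF s, of \<mu>] by simp
    have "has_bochner_integral lborel (\<lambda>x. normal_density \<mu> s x * x ^ (2 * k)) (fact (2 * k) / ((2 / s\<^sup>2)^k * fact k))" for k
      using normal_moment_even[OF s, of 0 k] mu by simp
    then have m: "integrable M (\<lambda>\<omega>. Z \<omega> ^ (2 * k))"
      "(\<integral>\<omega>. Z \<omega> ^ (2 * k) \<partial>M) = fact (2 * k) / ((2 / s\<^sup>2)^k * fact k)" for k
      using d[of "\<lambda>x. x ^ (2 * k)"] by (auto simp: has_bochner_integral_iff)
    have "(\<integral>\<omega>. (Z \<omega>)\<^sup>2 \<partial>M) = s\<^sup>2" using m(2)[of 1] by (simp add: fact_numeral)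
    then show ?thesis using m[of q] by (simp add: power_divide)
  qed
  then show "integrable M (\<lambda>\<omega>. Z \<omega> ^ (2 * q))"
    and "(\<integral>\<omega>. Z \<omega> ^ (2 * q) \<partial>M) = fact (2 * q) / (2 ^ q * fact q) * (\<integral>\<omega>. (Z \<omega>)\<^sup>2 \<partial>M) ^ q" by auto
qed

section \<open>Exponential means of the variance function\<close>

definition fbm_var :: "real \<Rightarrow> real \<Rightarrow> real" where
  "fbm_var H u = \<bar>u\<bar> powr (2 * H)"

lemma fbm_var_minus [simp]: "fbm_var H (- u) = fbm_var H u"
  by (simp add: fbm_var_def)

lemma subcubic_fbm_var:
  assumes "0 < H" "H \<le> 1"
  shows "subcubic (fbm_var H)"
proof (rule subcubicI)
  show "continuous_on UNIV (fbm_var H)"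
    unfolding fbm_var_def[abs_def] using assms
    by (intro continuous_on_powr' continuous_intros) auto
  show "\<bar>fbm_var H s\<bar> \<le> 1 * (1 + \<bar>s\<bar>) ^ 3" for s
  proof -
    have "\<bar>s\<bar> powr (2 * H) \<le> (1 + \<bar>s\<bar>) powr (2 * H)" using assms by (intro powr_mono2) auto
    also have "\<dots> \<le> (1 + \<bar>s\<bar>) powr 3" using assms by (intro powr_mono) auto
    also have "\<dots> = (1 + \<bar>s\<bar>) ^ 3" by (subst powr_numeral) auto
    finally show ?thesis by (simp add: fbm_var_def)
  qed
qed

text \<open>The substitution s = l v gives a Gamma integral. This is the initial value for the
  equation solved in \<open>expmean_fbm_var\<close>.\<close>

lemma expmean_fbm_var_0:
  assumes H: "0 < H" and l: "l > 0"
  shows "expmean l (fbm_var H) 0 = l powr (- 2 * H) * Gamma (2 * H + 1)"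
proof -
  let ?f = "\<lambda>s. indicator {0..} s * (s powr (2 * H) / exp s)"
  have [measurable]: "fbm_var H \<in> borel_measurable borel" unfolding fbm_var_def[abs_def] by measurable
  have "((\<lambda>s. s powr (2 * H) / exp s) has_integral Gamma (2 * H + 1)) {0..}"
    using Gamma_integral_real[of "2 * H + 1"] H by simp
  then have G: "(\<integral>s. ?f s \<partial>lborel) = Gamma (2 * H + 1)"
    using H by (intro has_bochner_integral_integral_eq has_bochner_integral_nn_integral nn_integral_has_integral_lebesgue)
      (auto intro: less_imp_le Gamma_real_pos)
  have eq: "exponential_density l v *\<^sub>R fbm_var H (0 - v) = l * l powr (- 2 * H) * ?f (0 + l * v)" for v
  proof (cases "v \<ge> 0")
    case True
    have "(l * v) powr (2 * H) = l powr (2 * H) * v powr (2 * H)" by (rule powr_mult)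
    then show ?thesis
      using True l by (simp add: fbm_var_def exponential_density_def exp_minus powr_minus field_simps)
  next
    case False
    then show ?thesis using l by (simp add: exponential_density_def mult_less_0_iff zero_le_mult_iff)
  qed
  have "expmean l (fbm_var H) 0 = (\<integral>v. exponential_density l v *\<^sub>R fbm_var H (0 - v) \<partial>lborel)"
    unfolding expmean_def by (subst integral_density) (auto simp: exponential_density_nonneg[OF l])
  also have "\<dots> = l powr (- 2 * H) * (l * (\<integral>v. ?f (0 + l * v) \<partial>lborel))"
    unfolding eq by (subst integral_mult_right_zero) (simp only: ac_simps)
  also have "l * (\<integral>v. ?f (0 + l * v) \<partial>lborel) = (\<integral>s. ?f s \<partial>lborel)"
    using l by (subst (2) lborel_integral_real_affine[of l _ 0]) auto
  finally show ?thesis unfolding G .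
qed

text \<open>The sign c treats both half-lines at once. The integrating factor reduces the equation
  of the exponential mean to an integral of its source term; rescaling time by l accounts for the
  power of l.\<close>

lemma expmean_fbm_var:
  assumes H: "0 < H" "H \<le> 1" and l: "l > 0" and t: "t \<ge> 0" and c: "c = 1 \<or> c = -1"
  shows "exp (c * (l * t)) * expmean l (fbm_var H) (c * t) =
    l powr (- 2 * H) * (Gamma (2 * H + 1) + c * integral {0..l * t} (\<lambda>s. exp (c * s) * s powr (2 * H)))"
proof -
  let ?m = "expmean l (fbm_var H)"
  define h where "h s = exp (c * s) * s powr (2 * H)" for s
  define Q where "Q x = integral {0..x} h" for x
  \<comment> \<open>Collects the terms depending on t: D is shown to be constant, and
    \<open>D 0\<close> is the Gamma term.\<close>
  define D where "D s = exp (c * (l * s)) * ?m (c * s) - l powr (- 2 * H) * c * Q (l * s)" for s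
  have conth: "continuous_on {0..l * t} h"
    unfolding h_def[abs_def] using H by (intro continuous_on_powr' continuous_intros) auto
  have dQ: "(Q has_real_derivative h x) (at x within {0..l * t})" if "x \<in> {0..l * t}" for x
    unfolding Q_def[abs_def] using conth that by (rule integral_has_real_derivative)
  have cc: "c * c = 1" "\<bar>c\<bar> = 1" using c by auto
  \<comment> \<open>Derivatives are taken within the interval because Q, an integral from 0 upwards,
    is a primitive of h only for nonnegative arguments.\<close>
  have dD: "(D has_real_derivative 0) (at s within {0..t})" if s: "s \<in> {0..t}" for s
  proof -
    have img: "(\<lambda>s. l * s) ` {0..t} = {0..l * t}" using l t by (simp add: image_mult_atLeastAtMost)
    have "(Q has_real_derivative h (l * s)) (at (l * s) within (\<lambda>s. l * s) ` {0..t})"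
      unfolding img using s l by (intro dQ) auto
    then have dQl: "((\<lambda>s. Q (l * s)) has_real_derivative h (l * s) * l) (at s within {0..t})"
      by (rule DERIV_image_chain[of Q _ "\<lambda>s. l * s", unfolded o_def]) (auto intro!: derivative_eq_intros)
    have dm: "((\<lambda>s. ?m (c * s)) has_real_derivative l * (fbm_var H (c * s) - ?m (c * s)) * c) (at s within {0..t})"
      by (rule DERIV_chain2[OF expmean_has_derivative[OF subcubic_fbm_var[OF H] l]])
        (auto intro!: derivative_eq_intros)
    have "fbm_var H (c * s) = s powr (2 * H)" using s cc by (simp add: fbm_var_def abs_mult)
    moreover have "h (l * s) = exp (c * (l * s)) * (l powr (2 * H) * s powr (2 * H))"
      using l s by (simp add: h_def powr_mult)
    moreover have "l powr (- 2 * H) * l powr (2 * H) = 1" using l by (simp add: powr_add[symmetric])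
    ultimately have *: "exp (c * (l * s)) * (c * l) * ?m (c * s) + exp (c * (l * s)) * (l * (fbm_var H (c * s) - ?m (c * s)) * c)
       - l powr (- 2 * H) * c * (h (l * s) * l) = 0"
      by (simp add: algebra_simps) 
    show ?thesis
      unfolding D_def
      by (rule derivative_eq_intros dm dQl refl)+ (use * in \<open>simp add: algebra_simps\<close>)
  qed
  have "D t = D 0"
    using has_field_derivative_zero_constant[OF convex_real_interval(5)[of 0 t] dD] t by force
  moreover have "D 0 = l powr (- 2 * H) * Gamma (2 * H + 1)"
    by (simp add: D_def Q_def expmean_fbm_var_0[OF H(1) l])
  ultimately show ?thesis by (simp add: D_def Q_def h_def[abs_def] algebra_simps)
qed

text \<open>Trades the exponent 2H - 1 of \<open>f_cov\<close>, singular at 0 when H < 1/2, for the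
  exponent 2H of the exponential means.\<close>

lemma integral_exp_powr_by_parts:
  fixes H c x :: real
  assumes H: "0 < H" and x: "x \<ge> 0"
  shows "2 * H * integral {0..x} (\<lambda>s. exp (c * s) * s powr (2 * H - 1)) =
    exp (c * x) * x powr (2 * H) - c * integral {0..x} (\<lambda>s. exp (c * s) * s powr (2 * H))"
proof -
  let ?h = "\<lambda>s. exp (c * s) * s powr (2 * H)"
  have cont: "continuous_on {0..x} ?h"
    using H by (intro continuous_on_powr' continuous_intros) auto
  have "((\<lambda>s. c * ?h s + 2 * H * (exp (c * s) * s powr (2 * H - 1))) has_integral (?h x - ?h 0)) {0..x}"
  \<comment> \<open>This version asks for derivatives only in the interior:
    \<open>s powr (2 * H)\<close> need not be differentiable at 0.\<close>
  proof (rule fundamental_theorem_of_calculus_interior[OF x cont])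
    fix s assume s: "s \<in> {0<..<x}"
    then have "(?h has_real_derivative c * ?h s + 2 * H * (exp (c * s) * s powr (2 * H - 1))) (at s)"
      by (auto intro!: derivative_eq_intros simp: algebra_simps powr_diff)
    then show "(?h has_vector_derivative c * ?h s + 2 * H * (exp (c * s) * s powr (2 * H - 1))) (at s)"
      by (simp add: has_real_derivative_iff_has_vector_derivative)
  qed
  moreover have "((\<lambda>s. c * ?h s) has_integral c * integral {0..x} ?h) {0..x}"
    by (intro has_integral_mult_right integrable_integral integrable_continuous_real cont)
  ultimately have "((\<lambda>s. 2 * H * (exp (c * s) * s powr (2 * H - 1))) has_integral
      (?h x - ?h 0 - c * integral {0..x} ?h)) {0..x}"
    using has_integral_diff[of "\<lambda>s. c * ?h s + 2 * H * (exp (c * s) * s powr (2 * H - 1))" "?h x - ?h 0" "{0..x}" "\<lambda>s. c * ?h s"]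
    by simp
  then have "integral {0..x} (\<lambda>s. 2 * H * (exp (c * s) * s powr (2 * H - 1))) = ?h x - ?h 0 - c * integral {0..x} ?h"
    by (rule integral_unique)
  then show ?thesis using H by simp
qed

text \<open>Both sides are even in t, so t \<ge> 0 suffices. Adding the formulas for c = 1 and c =
  -1 and integrating by parts leaves two equal boundary terms, which \<open>2 * fbm_var H t\<close>
  cancels.\<close>

lemma expmean_fbm_var_f_cov:
  assumes H: "0 < H" "H \<le> 1" and l: "l > 0"
  shows "expmean l (fbm_var H) t + expmean l (fbm_var H) (- t) - 2 * fbm_var H t =
    2 * H * l powr (- 2 * H) * f_cov H (l * \<bar>t\<bar>)"
proof -
  have pos: "expmean l (fbm_var H) t + expmean l (fbm_var H) (- t) - 2 * fbm_var H t =
    2 * H * l powr (- 2 * H) * f_cov H (l * t)" if t: "t \<ge> 0" for t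
  proof -
    define x where "x = l * t"
    have x: "x \<ge> 0" using t l by (simp add: x_def)
    define q where "q = l powr (- 2 * H)"
    define G where "G = Gamma (2 * H)"
    define Q R where "Q = integral {0..x} (\<lambda>s. exp s * s powr (2 * H))"
      and "R = integral {0..x} (\<lambda>s. exp (- s) * s powr (2 * H))"
    have "2 * H \<notin> \<int>\<^sub>\<le>\<^sub>0" using H nonpos_Ints_nonpos[of "2 * H"] by linarith
    then have G: "Gamma (2 * H + 1) = 2 * H * G" unfolding G_def by (rule Gamma_plus1)
    have ee: "exp x * exp (- x) = 1" by (simp add: exp_add[symmetric])
    have "exp x * expmean l (fbm_var H) t = q * (2 * H * G + Q)"
      using expmean_fbm_var[OF H l t, of 1] by (simp add: x_def q_def Q_def G)
    from arg_cong[OF this, of "\<lambda>z. exp (- x) * z"]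
    have a: "expmean l (fbm_var H) t = exp (- x) * (q * (2 * H * G + Q))"
      using ee by (simp add: mult.assoc[symmetric] mult.commute)
    have "exp (- x) * expmean l (fbm_var H) (- t) = q * (2 * H * G - R)"
      using expmean_fbm_var[OF H l t, of "-1"] by (simp add: x_def q_def R_def G)
    from arg_cong[OF this, of "\<lambda>z. exp x * z"]
    have n: "expmean l (fbm_var H) (- t) = exp x * (q * (2 * H * G - R))"
      using ee by (simp add: mult.assoc[symmetric])
    have "x powr (2 * H) = l powr (2 * H) * t powr (2 * H)" using l t by (simp add: x_def powr_mult)
    then have v: "fbm_var H t = q * x powr (2 * H)"
      using l t by (simp add: fbm_var_def q_def powr_minus)
    define J K where "J = integral {0..x} (\<lambda>s. exp s * s powr (2 * H - 1))"
      and "K = integral {0..x} (\<lambda>s. exp (- s) * s powr (2 * H - 1))"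
    have J: "2 * H * J = exp x * x powr (2 * H) - Q"
      using integral_exp_powr_by_parts[OF H(1) x, of 1] by (simp add: J_def Q_def)
    have K: "2 * H * K = exp (- x) * x powr (2 * H) + R"
      using integral_exp_powr_by_parts[OF H(1) x, of "-1"] by (simp add: K_def R_def)
    have "2 * H * f_cov H x = exp (- x) * (2 * H * G - 2 * H * J) + exp x * (2 * H * G - 2 * H * K)"
      unfolding f_cov_def G_def J_def K_def by (simp add: algebra_simps)
    also have "\<dots> = exp (- x) * (2 * H * G + Q) + exp x * (2 * H * G - R) - 2 * (exp x * exp (- x)) * x powr (2 * H)"
      unfolding J K by (simp add: algebra_simps)
    finally have f: "2 * H * f_cov H x = exp (- x) * (2 * H * G + Q) + exp x * (2 * H * G - R) - 2 * x powr (2 * H)"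
      unfolding ee by simp
    have "expmean l (fbm_var H) t + expmean l (fbm_var H) (- t) - 2 * fbm_var H t = q * (2 * H * f_cov H x)"
      unfolding a n v f by (simp add: algebra_simps)
    then show ?thesis by (simp add: q_def x_def ac_simps)
  qed
  show ?thesis
  proof (cases "t \<ge> 0")
    case True
    then show ?thesis using pos[OF True] by simp
  next
    case False
    then show ?thesis using pos[of "- t"] by simp
  qed
qed

section \<open>Covariances\<close>

text \<open>Rounding time down to a grid of mesh \<open>1 / Suc n\<close> leaves countably many
  times, hence joint measurability; by path continuity the rounded processes converge
  pointwise.\<close>

lemma measurable_pair_continuous_paths:
  fixes Y :: "real \<Rightarrow> 'a \<Rightarrow> real"
  assumes [measurable]: "\<And>t. Y t \<in> borel_measurable M"
    and cont: "\<And>\<omega>. continuous_on UNIV (\<lambda>t. Y t \<omega>)"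
  shows "(\<lambda>(\<omega>, t). Y t \<omega>) \<in> borel_measurable (M \<Otimes>\<^sub>M borel)"
proof (rule borel_measurable_LIMSEQ_real)
  fix n :: nat
  show "(\<lambda>p. Y (of_int \<lfloor>snd p * real (Suc n)\<rfloor> / real (Suc n)) (fst p)) \<in> borel_measurable (M \<Otimes>\<^sub>M borel)"
    by (rule measurable_compose_countable[where f = "\<lambda>i p. Y (of_int i / real (Suc n)) (fst p)"]) measurable
next
  fix p assume "p \<in> space (M \<Otimes>\<^sub>M (borel :: real measure))"
  obtain \<omega> t where p: "p = (\<omega>, t)" by (cases p)
  have lim0: "(\<lambda>n. t - 1 / real (Suc n)) \<longlonglongrightarrow> t - 0"
    by (intro tendsto_intros LIMSEQ_Suc lim_1_over_n)
  have "(\<lambda>n. of_int \<lfloor>t * real (Suc n)\<rfloor> / real (Suc n)) \<longlonglongrightarrow> t"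
  proof (rule tendsto_sandwich[of "\<lambda>n. t - 1 / real (Suc n)" _ _ "\<lambda>n. t"])
    have "t - 1 / real (Suc n) \<le> of_int \<lfloor>t * real (Suc n)\<rfloor> / real (Suc n)" for n
    proof -
      have "t * real (Suc n) - 1 \<le> of_int \<lfloor>t * real (Suc n)\<rfloor>" by linarith
      from divide_right_mono[OF this, of "real (Suc n)"] show ?thesis by (simp add: diff_divide_distrib)
    qed
    then show "\<forall>\<^sub>F n in sequentially. t - 1 / real (Suc n) \<le> of_int \<lfloor>t * real (Suc n)\<rfloor> / real (Suc n)" by simp
    have "of_int \<lfloor>t * real (Suc n)\<rfloor> / real (Suc n) \<le> t" for n
      by (simp add: divide_le_eq del: of_nat_Suc)
    then show "\<forall>\<^sub>F n in sequentially. of_int \<lfloor>t * real (Suc n)\<rfloor> / real (Suc n) \<le> t" by simp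
  qed (use lim0 in auto)
  then show "(\<lambda>n. Y (of_int \<lfloor>snd p * real (Suc n)\<rfloor> / real (Suc n)) (fst p)) \<longlonglongrightarrow> (case p of (\<omega>, t) \<Rightarrow> Y t \<omega>)"
    unfolding p using continuous_on_tendsto_compose[OF cont[of \<omega>]] by simp
qed

lemma abs_mult_le_sum_squares: "\<bar>a\<bar> * \<bar>b\<bar> \<le> a\<^sup>2 + b\<^sup>2" "\<bar>a * b\<bar> \<le> a\<^sup>2 + b\<^sup>2" for a b :: real
proof -
  show "\<bar>a\<bar> * \<bar>b\<bar> \<le> a\<^sup>2 + b\<^sup>2"
    using sum_squares_bound[of "\<bar>a\<bar>" "\<bar>b\<bar>"] mult_nonneg_nonneg[of "\<bar>a\<bar>" "\<bar>b\<bar>"]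
    unfolding mult.assoc power2_abs by linarith
  then show "\<bar>a * b\<bar> \<le> a\<^sup>2 + b\<^sup>2" by (simp add: abs_mult)
qed

text \<open>The bound of a product by the sum of the squares supplies the integrability for Fubini;
  Jensen gives the square integrability of the mean.\<close>

lemma (in prob_space) mean_of_square_integrable_family:
  fixes Z :: "'a \<Rightarrow> real" and W :: "'a \<Rightarrow> 'b \<Rightarrow> real"
  assumes E: "prob_space E"
    and W [measurable]: "case_prod W \<in> borel_measurable (M \<Otimes>\<^sub>M E)"
    and Z [measurable]: "Z \<in> borel_measurable M" and Z2: "integrable M (\<lambda>\<omega>. (Z \<omega>)\<^sup>2)"
    and W2: "\<And>v. integrable M (\<lambda>\<omega>. (W \<omega> v)\<^sup>2)"
    and W2E: "integrable E (\<lambda>v. \<integral>\<omega>. (W \<omega> v)\<^sup>2 \<partial>M)"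
  shows "(\<integral>\<omega>. Z \<omega> * (\<integral>v. W \<omega> v \<partial>E) \<partial>M) = (\<integral>v. (\<integral>\<omega>. Z \<omega> * W \<omega> v \<partial>M) \<partial>E)"
    and "integrable M (\<lambda>\<omega>. (\<integral>v. W \<omega> v \<partial>E)\<^sup>2)"
    and "(\<lambda>\<omega>. \<integral>v. W \<omega> v \<partial>E) \<in> borel_measurable M"
proof -
  interpret E: prob_space E by fact
  interpret P: pair_sigma_finite M E ..
  have int_W2: "integrable (M \<Otimes>\<^sub>M E) (\<lambda>(\<omega>, v). (W \<omega> v)\<^sup>2)"
  proof (rule integrableI_bounded)
    have "(\<integral>\<^sup>+p. ennreal (norm (case p of (\<omega>, v) \<Rightarrow> (W \<omega> v)\<^sup>2)) \<partial>(M \<Otimes>\<^sub>M E)) =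
        (\<integral>\<^sup>+v. \<integral>\<^sup>+\<omega>. ennreal ((W \<omega> v)\<^sup>2) \<partial>M \<partial>E)"
      by (subst P.nn_integral_snd[symmetric]) (auto simp: split_beta')
    also have "\<dots> = (\<integral>\<^sup>+v. ennreal (\<integral>\<omega>. (W \<omega> v)\<^sup>2 \<partial>M) \<partial>E)"
      by (intro nn_integral_cong nn_integral_eq_integral W2) auto
    also have "\<dots> = ennreal (\<integral>v. \<integral>\<omega>. (W \<omega> v)\<^sup>2 \<partial>M \<partial>E)"
      by (intro nn_integral_eq_integral W2E) auto
    finally show "(\<integral>\<^sup>+p. ennreal (norm (case p of (\<omega>, v) \<Rightarrow> (W \<omega> v)\<^sup>2)) \<partial>(M \<Otimes>\<^sub>M E)) < \<infinity>" by simp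
  qed measurable
  have int_Z2: "integrable (M \<Otimes>\<^sub>M E) (\<lambda>(\<omega>, v). (Z \<omega>)\<^sup>2)"
  proof (rule integrableI_bounded)
    have "(\<integral>\<^sup>+p. ennreal (norm (case p of (\<omega>, v) \<Rightarrow> (Z \<omega>)\<^sup>2)) \<partial>(M \<Otimes>\<^sub>M E)) =
        (\<integral>\<^sup>+\<omega>. \<integral>\<^sup>+v. ennreal ((Z \<omega>)\<^sup>2) \<partial>E \<partial>M)"
      by (subst E.nn_integral_fst[symmetric]) (auto simp: split_beta')
    also have "\<dots> = ennreal (\<integral>\<omega>. (Z \<omega>)\<^sup>2 \<partial>M)"
      using nn_integral_eq_integral[OF Z2] by (simp add: E.emeasure_space_1)
    finally show "(\<integral>\<^sup>+p. ennreal (norm (case p of (\<omega>, v) \<Rightarrow> (Z \<omega>)\<^sup>2)) \<partial>(M \<Otimes>\<^sub>M E)) < \<infinity>" by simp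
  qed measurable
  have int_ZW: "integrable (M \<Otimes>\<^sub>M E) (\<lambda>(\<omega>, v). Z \<omega> * W \<omega> v)"
  proof (rule Bochner_Integration.integrable_bound)
    show "integrable (M \<Otimes>\<^sub>M E) (\<lambda>p. (case p of (\<omega>, v) \<Rightarrow> (Z \<omega>)\<^sup>2) + (case p of (\<omega>, v) \<Rightarrow> (W \<omega> v)\<^sup>2))"
      by (intro Bochner_Integration.integrable_add int_Z2 int_W2)
    show "AE p in M \<Otimes>\<^sub>M E. norm (case p of (\<omega>, v) \<Rightarrow> Z \<omega> * W \<omega> v) \<le>
        norm ((case p of (\<omega>, v) \<Rightarrow> (Z \<omega>)\<^sup>2) + (case p of (\<omega>, v) \<Rightarrow> (W \<omega> v)\<^sup>2))"
      by (auto simp: split_beta' abs_mult_le_sum_squares)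
  qed measurable
  show "(\<integral>\<omega>. Z \<omega> * (\<integral>v. W \<omega> v \<partial>E) \<partial>M) = (\<integral>v. (\<integral>\<omega>. Z \<omega> * W \<omega> v \<partial>M) \<partial>E)"
    using P.Fubini_integral[OF int_ZW] by simp
  show meas: "(\<lambda>\<omega>. \<integral>v. W \<omega> v \<partial>E) \<in> borel_measurable M" by measurable
  show "integrable M (\<lambda>\<omega>. (\<integral>v. W \<omega> v \<partial>E)\<^sup>2)"
  proof (rule Bochner_Integration.integrable_bound)
    show "integrable M (\<lambda>\<omega>. \<integral>v. (W \<omega> v)\<^sup>2 \<partial>E)"
      using P.integrable_fst'[OF int_W2] by simp
    show "AE \<omega> in M. norm ((\<integral>v. W \<omega> v \<partial>E)\<^sup>2) \<le> norm (\<integral>v. (W \<omega> v)\<^sup>2 \<partial>E)"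
      using P.AE_integrable_fst'[OF int_W2] AE_space
    proof eventually_elim
      case (elim \<omega>)
      then have sq: "integrable E (\<lambda>v. (W \<omega> v)\<^sup>2)" by simp
      have [measurable]: "W \<omega> \<in> borel_measurable E" using elim(2) by measurable
      have "integrable E (W \<omega>)" using sq by (rule E.square_integrable_imp_integrable[rotated]) measurable
      \<comment> \<open>Jensen's inequality for the square, read off from the nonnegative variance
        of \<open>W \<omega>\<close> under E.\<close>
      then have "0 \<le> (\<integral>v. (W \<omega> v)\<^sup>2 \<partial>E) - (\<integral>v. W \<omega> v \<partial>E)\<^sup>2"
        using E.variance_eq[of "W \<omega>"] sq E.variance_positive[of "W \<omega>"] by simp
      then show ?case by simp
    qed
  qed (use meas in measurable)
qed

text \<open>The exponential law has mass 1, so \<open>T_op k\<close> averages the increments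
  \<open>Y t - Y (t - v)\<close> and only covariances of increments enter. Two uses of Fubini lead
  to the reflected mean n and to \<open>expmean m n\<close>, and the uniqueness principle evaluates
  the latter.\<close>

lemma (in prob_space) T_op_paths_cov:
  fixes Y :: "real \<Rightarrow> 'a \<Rightarrow> real"
  assumes H: "0 < H" "H \<le> 1"
    and Y [measurable]: "\<And>t. Y t \<in> borel_measurable M"
    and paths: "\<And>\<omega>. subcubic (\<lambda>t. Y t \<omega>)"
    and sq: "\<And>t. integrable M (\<lambda>\<omega>. (Y t \<omega>)\<^sup>2)"
    and cov: "\<And>s t. (\<integral>\<omega>. Y s \<omega> * Y t \<omega> \<partial>M) = (fbm_var H s + fbm_var H t - fbm_var H (s - t)) / 2"
    and l: "l > 0" and m: "m > 0"
  shows "integrable M (\<lambda>\<omega>. (T_op l (\<lambda>t. Y t \<omega>) t)\<^sup>2)"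
    and "(\<lambda>\<omega>. T_op l (\<lambda>t. Y t \<omega>) t) \<in> borel_measurable M"
    and "(\<integral>\<omega>. T_op l (\<lambda>t. Y t \<omega>) 0 * T_op m (\<lambda>t. Y t \<omega>) t \<partial>M) =
      (l * (expmean l (fbm_var H) (- t) - fbm_var H t) + m * (expmean m (fbm_var H) t - fbm_var H t)) / (2 * (l + m))"
proof -
  let ?\<phi> = "fbm_var H"
  have \<phi>: "subcubic ?\<phi>" by (rule subcubic_fbm_var[OF H])
  have prod: "integrable M (\<lambda>\<omega>. Y s \<omega> * Y t \<omega>)" for s t
  proof (rule Bochner_Integration.integrable_bound)
    show "integrable M (\<lambda>\<omega>. (Y s \<omega>)\<^sup>2 + (Y t \<omega>)\<^sup>2)" using sq by simp
    show "AE \<omega> in M. norm (Y s \<omega> * Y t \<omega>) \<le> norm ((Y s \<omega>)\<^sup>2 + (Y t \<omega>)\<^sup>2)"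
      by (auto simp: abs_mult_le_sum_squares)
  qed measurable
  have incr_expand: "(\<lambda>\<omega>. (Y a \<omega> - Y b \<omega>) * (Y c \<omega> - Y d \<omega>)) =
      (\<lambda>\<omega>. Y a \<omega> * Y c \<omega> - Y a \<omega> * Y d \<omega> - Y b \<omega> * Y c \<omega> + Y b \<omega> * Y d \<omega>)" for a b c d
    by (simp add: algebra_simps)
  have incr_int: "integrable M (\<lambda>\<omega>. (Y a \<omega> - Y b \<omega>) * (Y c \<omega> - Y d \<omega>))" for a b c d
    unfolding incr_expand using prod by simp
  \<comment> \<open>Terms depending on a single time cancel, leaving \<open>fbm_var H\<close> at the
    four time differences.\<close>
  have incr: "(\<integral>\<omega>. (Y a \<omega> - Y b \<omega>) * (Y c \<omega> - Y d \<omega>) \<partial>M) =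
      (?\<phi> (a - d) + ?\<phi> (b - c) - ?\<phi> (a - c) - ?\<phi> (b - d)) / 2" for a b c d
    unfolding incr_expand using prod by (simp add: cov field_simps)
  have joint: "(\<lambda>(\<omega>, t). Y t \<omega>) \<in> borel_measurable (M \<Otimes>\<^sub>M borel)"
    by (rule measurable_pair_continuous_paths[OF Y subcubic_continuous[OF paths]])
  define W where "W t \<omega> v = Y t \<omega> - Y (t - v) \<omega>" for t \<omega> v
  have W: "case_prod (W t) \<in> borel_measurable (M \<Otimes>\<^sub>M exp_law k)" for t k
  proof -
    have "(\<lambda>p. (\<lambda>(\<omega>, t). Y t \<omega>) (fst p, t - snd p)) \<in> borel_measurable (M \<Otimes>\<^sub>M exp_law k)"
      by (rule measurable_compose[OF _ joint]) measurable
    then have [measurable]: "(\<lambda>p. Y (t - snd p) (fst p)) \<in> borel_measurable (M \<Otimes>\<^sub>M exp_law k)" by simp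
    show ?thesis unfolding W_def split_beta' by measurable
  qed
  have T: "T_op k (\<lambda>t. Y t \<omega>) t = (\<integral>v. W t \<omega> v \<partial>exp_law k)" if k: "k > 0" for k \<omega> t
  proof -
    interpret E: prob_space "exp_law k" by (rule prob_space_exponential_density[OF k])
    have "(\<integral>v. W t \<omega> v \<partial>exp_law k) = (\<integral>v. Y t \<omega> \<partial>exp_law k) - (\<integral>v. Y (t - v) \<omega> \<partial>exp_law k)"
      unfolding W_def by (intro Bochner_Integration.integral_diff integrable_exp_law_subcubic[OF paths k]) simp
    then show ?thesis
      by (simp add: T_op_subcubic[OF paths k] expmean_def measure_exp_law_UNIV[OF k])
  qed
  \<comment> \<open>The argument has the form \<open>0 - v\<close> to match the integrand of an
    exponential mean at 0, known to be integrable.\<close>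
  have W2: "integrable M (\<lambda>\<omega>. (W t \<omega> v)\<^sup>2)" "(\<integral>\<omega>. (W t \<omega> v)\<^sup>2 \<partial>M) = ?\<phi> (0 - v)" for t v
  proof -
    show "integrable M (\<lambda>\<omega>. (W t \<omega> v)\<^sup>2)" using incr_int by (simp add: W_def power2_eq_square)
    have "?\<phi> 0 = 0" by (simp add: fbm_var_def)
    then show "(\<integral>\<omega>. (W t \<omega> v)\<^sup>2 \<partial>M) = ?\<phi> (0 - v)"
      using incr[of t "t - v" t "t - v"] by (simp add: W_def power2_eq_square)
  qed
  have mean: "(\<integral>\<omega>. Z \<omega> * T_op k (\<lambda>t. Y t \<omega>) t \<partial>M) = (\<integral>v. (\<integral>\<omega>. Z \<omega> * W t \<omega> v \<partial>M) \<partial>exp_law k)"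
    "integrable M (\<lambda>\<omega>. (T_op k (\<lambda>t. Y t \<omega>) t)\<^sup>2)"
    "(\<lambda>\<omega>. T_op k (\<lambda>t. Y t \<omega>) t) \<in> borel_measurable M"
    if "k > 0" "Z \<in> borel_measurable M" "integrable M (\<lambda>\<omega>. (Z \<omega>)\<^sup>2)" for k Z t
    unfolding T[OF that(1)]
    using mean_of_square_integrable_family[OF prob_space_exponential_density[OF that(1)] W that(2,3) W2(1)]
      integrable_exp_law_subcubic[OF \<phi> that(1), of 0]
    by (simp_all add: W2(2))
  show TL2: "integrable M (\<lambda>\<omega>. (T_op l (\<lambda>t. Y t \<omega>) t)\<^sup>2)" and Tmeas: "(\<lambda>\<omega>. T_op l (\<lambda>t. Y t \<omega>) t) \<in> borel_measurable M" for t
    using mean(2,3)[OF l, of "\<lambda>_. 0"] by auto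
  define n where "n = (\<lambda>t. expmean l ?\<phi> (- t))"
  define a where "a = expmean m ?\<phi>"
  have n: "subcubic n" unfolding n_def by (intro subcubic_reflect subcubic_expmean \<phi> l)
  have a: "subcubic a" unfolding a_def by (intro subcubic_expmean \<phi> m)
  have n_alt: "n t = (\<integral>u. ?\<phi> (t + u) \<partial>exp_law l)" for t
  proof -
    have "?\<phi> (- t - u) = ?\<phi> (t + u)" for u using fbm_var_minus[of H "t + u"] by (simp add: algebra_simps)
    then show ?thesis by (simp add: n_def expmean_def)
  qed
  have int_n: "integrable (exp_law l) (\<lambda>u. ?\<phi> (t + u))" for t
  proof -
    have "?\<phi> (- t - u) = ?\<phi> (t + u)" for u using fbm_var_minus[of H "t + u"] by (simp add: algebra_simps)
    then show ?thesis using integrable_exp_law_subcubic[OF \<phi> l, of "- t"] by simp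
  qed
  \<comment> \<open>Fubini over the law of rate l, with the increment \<open>W t \<omega> v\<close>
    as the fixed factor.\<close>
  have inner: "(\<integral>\<omega>. T_op l (\<lambda>t. Y t \<omega>) 0 * W t \<omega> v \<partial>M) = ((n t - ?\<phi> t) - (n (t - v) - ?\<phi> (t - v))) / 2" for v
  proof -
    interpret E: prob_space "exp_law l" by (rule prob_space_exponential_density[OF l])
    have "(\<integral>\<omega>. T_op l (\<lambda>t. Y t \<omega>) 0 * W t \<omega> v \<partial>M) = (\<integral>\<omega>. W t \<omega> v * T_op l (\<lambda>t. Y t \<omega>) 0 \<partial>M)"
      by (simp add: mult.commute)
    also have "\<dots> = (\<integral>u. (\<integral>\<omega>. W t \<omega> v * W 0 \<omega> u \<partial>M) \<partial>exp_law l)"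
      by (rule mean(1)[OF l _ W2(1)]) (simp add: W_def)
    also have "\<dots> = (\<integral>u. (?\<phi> (t + u) + ?\<phi> (t - v) - ?\<phi> t - ?\<phi> (t - v + u)) / 2 \<partial>exp_law l)"
      using incr[of t "t - v" 0] by (intro Bochner_Integration.integral_cong) (auto simp: W_def)
    also have "\<dots> = (n t + ?\<phi> (t - v) - ?\<phi> t - n (t - v)) / 2"
      using int_n[of t] int_n[of "t - v"] by (simp add: n_alt measure_exp_law_UNIV[OF l])
    finally show ?thesis by simp
  qed
  have "(\<integral>\<omega>. T_op l (\<lambda>t. Y t \<omega>) 0 * T_op m (\<lambda>t. Y t \<omega>) t \<partial>M) =
      (\<integral>v. ((n t - ?\<phi> t) - (n (t - v) - ?\<phi> (t - v))) / 2 \<partial>exp_law m)"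
    using mean(1)[OF m Tmeas TL2, of 0 t] by (simp add: inner)
  also have "\<dots> = ((n t - ?\<phi> t) - (expmean m n t - a t)) / 2"
  proof -
    interpret E: prob_space "exp_law m" by (rule prob_space_exponential_density[OF m])
    show ?thesis
      using integrable_exp_law_subcubic[OF n m, of t] integrable_exp_law_subcubic[OF \<phi> m, of t]
      by (simp add: expmean_def a_def measure_exp_law_UNIV[OF m])
  qed
  \<comment> \<open>Reflection reverses the sign in the equation of n, so in the combination with
    weights m / (l + m) and l / (l + m) the source terms of n and a cancel. What remains is the
    equation characterising \<open>expmean m n\<close>.\<close>
  also have "expmean m n t = m / (l + m) * n t + l / (l + m) * a t"
  proof -
    have dn: "(n has_real_derivative l * (n t - ?\<phi> t)) (at t)" for t
      unfolding n_def
      by (rule DERIV_cong[OF DERIV_chain2[OF expmean_has_derivative[OF \<phi> l]]])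
        (auto intro!: derivative_eq_intros simp: algebra_simps)
    have da: "(a has_real_derivative m * (?\<phi> t - a t)) (at t)" for t
      unfolding a_def by (rule expmean_has_derivative[OF \<phi> m])
    have "expmean m n = (\<lambda>t. m / (l + m) * n t + l / (l + m) * a t)" (is "_ = ?z")
    proof (rule expmean_unique[OF n m])
      show "subcubic ?z" by (intro subcubic_add subcubic_cmult n a)
      fix t
      have "l + m \<noteq> 0" using l m by simp
      then have "m / (l + m) * (l * (n t - ?\<phi> t)) + l / (l + m) * (m * (?\<phi> t - a t)) = m * (n t - ?z t)"
        by (simp add: divide_simps) (simp add: algebra_simps)
      then show "(?z has_real_derivative m * (n t - ?z t)) (at t)"
        by (rule DERIV_cong[OF DERIV_add[OF DERIV_cmult[OF dn] DERIV_cmult[OF da]]])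
    qed
    then show ?thesis by simp
  qed
  also have "((n t - ?\<phi> t) - (m / (l + m) * n t + l / (l + m) * a t - a t)) / 2 =
      (l * (n t - ?\<phi> t) + m * (a t - ?\<phi> t)) / (2 * (l + m))"
  proof -
    have "l + m \<noteq> 0" using l m by simp
    then show ?thesis by (simp add: divide_simps) (simp add: algebra_simps)
  qed
  finally show "(\<integral>\<omega>. T_op l (\<lambda>t. Y t \<omega>) 0 * T_op m (\<lambda>t. Y t \<omega>) t \<partial>M) =
      (l * (expmean l ?\<phi> (- t) - ?\<phi> t) + m * (expmean m ?\<phi> t - ?\<phi> t)) / (2 * (l + m))"
    by (simp add: n_def a_def)
qed


section \<open>Moments and growth of fractional Brownian motion\<close>

text \<open>Increments are linear combinations of the process, hence Gaussian, and the covariance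
  gives them variance \<open>fbm_var H (t - s)\<close>.\<close>

lemma fbm_moments:
  assumes M: "prob_space M" and B: "fractional_brownian_motion M H B"
  shows "integrable M (\<lambda>\<omega>. (B t \<omega>)\<^sup>2)"
    and "integrable M (\<lambda>\<omega>. (B t \<omega> - B s \<omega>) ^ (2 * q))"
    and "(\<integral>\<omega>. (B t \<omega> - B s \<omega>) ^ (2 * q) \<partial>M) = fact (2 * q) / (2 ^ q * fact q) * fbm_var H (t - s) ^ q"
proof -
  interpret prob_space M by fact
  have gp: "gaussian_process M B"
    and mean: "\<And>t. (\<integral>\<omega>. B t \<omega> \<partial>M) = 0"
    and cov: "\<And>s t. (\<integral>\<omega>. B s \<omega> * B t \<omega> \<partial>M) = (fbm_var H s + fbm_var H t - fbm_var H (s - t)) / 2"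
    using B by (auto simp: fractional_brownian_motion_def fbm_var_def)
  have B_meas [measurable]: "B t \<in> borel_measurable M" for t
    using gp by (simp add: gaussian_process_def)
  have lin: "gaussian_law (distr M borel (\<lambda>\<omega>. \<Sum>t\<in>J. a t * B t \<omega>))" if "finite J" for J a
    using gp that by (simp add: gaussian_process_def)
  have one: "gaussian_law (distr M borel (B t))" for t
    using lin[of "{t}" "\<lambda>_. 1"] by simp
  show sq: "integrable M (\<lambda>\<omega>. (B t \<omega>)\<^sup>2)" for t
    using gaussian_law_moments(1)[OF M B_meas one mean, where q = 1] by simp
  have int: "integrable M (B t)" for t
    using sq by (rule square_integrable_imp_integrable[rotated]) simp
  have prod: "integrable M (\<lambda>\<omega>. B t \<omega> * B s \<omega>)" for t s
    by (rule Bochner_Integration.integrable_bound[of M "\<lambda>\<omega>. (B t \<omega>)\<^sup>2 + (B s \<omega>)\<^sup>2"])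
      (use sq in \<open>auto simp: abs_mult_le_sum_squares\<close>)
  have gd: "gaussian_law (distr M borel (\<lambda>\<omega>. B t \<omega> - B s \<omega>))"
  \<comment> \<open>For t = s the index set \<open>{t, s}\<close> collapses to one point, so the
    zero increment is taken as the empty combination.\<close>
  proof (cases "t = s")
    case True
    then show ?thesis using lin[of "{}"] by simp
  next
    case False
    then show ?thesis using lin[of "{t, s}" "\<lambda>r. if r = t then 1 else - 1"] by simp
  qed
  have md: "(\<integral>\<omega>. B t \<omega> - B s \<omega> \<partial>M) = 0" using int mean by simp
  have "(\<integral>\<omega>. (B t \<omega> - B s \<omega>)\<^sup>2 \<partial>M) = (\<integral>\<omega>. B t \<omega> * B t \<omega> - 2 * (B t \<omega> * B s \<omega>) + B s \<omega> * B s \<omega> \<partial>M)"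
    by (simp add: power2_eq_square algebra_simps)
  also have "\<dots> = fbm_var H (t - s)"
    using prod by (simp add: cov) (simp add: fbm_var_def field_simps)
  finally have "(\<integral>\<omega>. (B t \<omega> - B s \<omega>)\<^sup>2 \<partial>M) = fbm_var H (t - s)" .
  with gaussian_law_moments[OF M _ gd md, where q = q]
  show "integrable M (\<lambda>\<omega>. (B t \<omega> - B s \<omega>) ^ (2 * q))"
    and "(\<integral>\<omega>. (B t \<omega> - B s \<omega>) ^ (2 * q) \<partial>M) = fact (2 * q) / (2 ^ q * fact q) * fbm_var H (t - s) ^ q"
    by auto
qed

text \<open>The moment of order 2q of an increment is a constant times \<bar>t - s\<bar> to the
  power 2Hq. Choosing q with 2Hq \<ge> 3 brings it below the cube for \<bar>t - s\<bar> \<le> 1,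
  however small H is.\<close>

lemma AE_fbm_subcubic:
  assumes M: "prob_space M" and B: "fractional_brownian_motion M H B"
  shows "AE \<omega> in M. subcubic (\<lambda>t. B t \<omega>)"
proof -
  interpret prob_space M by fact
  have H: "H > 0" using B by (simp add: fractional_brownian_motion_def)
  obtain q :: nat where q: "real q * (2 * H) \<ge> 3" "q > 0"
  proof -
    obtain q :: nat where "3 / (2 * H) < real q" using reals_Archimedean2 by blast
    moreover from this have "q > 0" using H by (metis divide_pos_pos gr_zeroI mult_pos_pos not_less_iff_gr_or_eq of_nat_0 order_less_trans zero_less_numeral)
    ultimately show thesis using H by (intro that[of q]) (auto simp: divide_simps)
  qed
  define c :: real where "c = fact (2 * q) / (2 ^ q * fact q)"
  show ?thesis
  proof (rule AE_subcubic_of_moments[where m = "2 * q" and c = c])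
    show "B t \<in> borel_measurable M" for t
      using B by (simp add: fractional_brownian_motion_def gaussian_process_def)
    show "AE \<omega> in M. continuous_on UNIV (\<lambda>t. B t \<omega>)"
      using B by (simp add: fractional_brownian_motion_def)
    show "c \<ge> 0" by (simp add: c_def)
    fix s t :: real assume st: "\<bar>t - s\<bar> \<le> 1"
    have "fbm_var H (t - s) ^ q \<le> \<bar>t - s\<bar> ^ 3"
    proof (cases "t = s")
      case True
      then show ?thesis using q by (simp add: fbm_var_def power_0_left)
    next
      case False
      then have "fbm_var H (t - s) ^ q = \<bar>t - s\<bar> powr (real q * (2 * H))"
        by (simp add: fbm_var_def powr_realpow[symmetric] powr_powr mult.commute)
      also have "\<dots> \<le> \<bar>t - s\<bar> powr 3" using q st False by (intro powr_mono') auto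
      also have "\<dots> = \<bar>t - s\<bar> ^ 3" using False by (subst powr_numeral) auto
      finally show ?thesis .
    qed
    then have "c * fbm_var H (t - s) ^ q \<le> c * \<bar>t - s\<bar> ^ 3"
      by (intro mult_left_mono) (auto simp: c_def)
    moreover have "(\<integral>\<^sup>+\<omega>. ennreal ((B t \<omega> - B s \<omega>) ^ (2 * q)) \<partial>M) = ennreal (c * fbm_var H (t - s) ^ q)"
      using fbm_moments(2,3)[OF M B, of t s q]
      by (subst nn_integral_eq_integral) (auto simp: c_def zero_le_even_power)
    ultimately show "(\<integral>\<^sup>+\<omega>. ennreal ((B t \<omega> - B s \<omega>) ^ (2 * q)) \<partial>M) \<le> ennreal (c * \<bar>t - s\<bar> ^ 3)"
      by (simp add: ennreal_leI)
  qed (use q in auto)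
qed

section \<open>Assembling the covariance formula\<close>

lemma T_comp_subcubic:
  assumes y: "subcubic y" and p: "p \<ge> 1" and pos: "\<And>i. i \<in> {1..p} \<Longrightarrow> l i > 0" and inj: "inj_on l {1..p}"
  shows "T_comp l p y t = (\<Sum>a\<in>l ` {1..p}. pf_coeff (l ` {1..p}) a * T_op a y t)"
proof -
  have set: "set (map l [1..<Suc p]) = l ` {1..p}"
    by (auto simp: atLeastLessThanSuc_atLeastAtMost simp del: upt_Suc)
  have "T_comp l p y = foldr T_op (map l [1..<Suc p]) y"
    by (simp add: T_comp_def foldr_map o_def del: upt_Suc)
  also have "\<dots> = (\<lambda>t. \<Sum>a\<in>set (map l [1..<Suc p]). pf_coeff (set (map l [1..<Suc p])) a * T_op a y t)"
  proof (rule foldr_T_op[OF y])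
    show "distinct (map l [1..<Suc p])"
      using inj by (simp add: distinct_map atLeastLessThanSuc_atLeastAtMost del: upt_Suc)
  qed (use p pos in \<open>auto simp del: upt_Suc\<close>)
  finally show ?thesis unfolding set by simp
qed

lemma T_op_cmult:
  assumes "subcubic y" "l > 0"
  shows "T_op l (\<lambda>s. c * y s) t = c * T_op l y t"
  using T_op_sum[of "{()}" "\<lambda>_. y" l "\<lambda>_. c" t] assms by simp

text \<open>The inner sum is a partial fraction expansion at x = a. Its factor b = a contributes
  1/2; the others pair with those of \<open>pf_coeff S a\<close> through (a - b)(a + b) = a^2 -
  b^2.\<close>

lemma pf_coeff_double_sum:
  assumes S: "finite S" "S \<noteq> {}" "\<And>a. a \<in> S \<Longrightarrow> a > 0" and a: "a \<in> S"
  shows "pf_coeff S a * (\<Sum>b\<in>S. pf_coeff S b * (a / (a + b))) =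
    a ^ (2 * (card S - 1)) / (\<Prod>b\<in>S - {a}. a\<^sup>2 - b\<^sup>2) / 2"
proof -
  have apos: "a > 0" using S a by auto
  have "(\<Sum>b\<in>S. pf_coeff S b * (a / (a + b))) = (\<Prod>b\<in>S. a / (a + b))"
    using S apos by (intro partial_fractions) (auto simp: add_pos_pos less_imp_neq[symmetric])
  also have "\<dots> = a / (a + a) * (\<Prod>b\<in>S - {a}. a / (a + b))"
    using S a by (intro prod.remove) auto
  also have "a / (a + a) = 1 / 2" using apos by simp
  finally have sum_eq: "(\<Sum>b\<in>S. pf_coeff S b * (a / (a + b))) = 1 / 2 * (\<Prod>b\<in>S - {a}. a / (a + b))" .
  have "pf_coeff S a * (\<Sum>b\<in>S. pf_coeff S b * (a / (a + b))) =
      (\<Prod>b\<in>S - {a}. a / (a - b) * (a / (a + b))) / 2"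
    unfolding sum_eq prod.distrib by (simp add: pf_coeff_def)
  also have "(\<Prod>b\<in>S - {a}. a / (a - b) * (a / (a + b))) = (\<Prod>b\<in>S - {a}. a\<^sup>2 / (a\<^sup>2 - b\<^sup>2))"
    by (simp add: power2_eq_square square_diff_square_factored mult.commute)
  also have "\<dots> = a ^ (2 * (card S - 1)) / (\<Prod>b\<in>S - {a}. a\<^sup>2 - b\<^sup>2)"
    using S a by (simp add: prod_dividef power_mult)
  finally show ?thesis .
qed

text \<open>Integrability belongs to the conclusion because the Bochner integral of a non-integrable
  function is 0 by convention; the formula alone would not assert that the expectation
  exists.\<close>

theorem proposition3:
  fixes M :: "'a measure" and B X :: "real \<Rightarrow> 'a \<Rightarrow> real"
    and H \<sigma> t :: real and p :: nat and l :: "nat \<Rightarrow> real"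
  assumes "prob_space M"
    and "0 < H" "H \<le> 1" and "\<sigma> > 0"
    and "fractional_brownian_motion M H B"
    and "p \<ge> 2"
    and "\<And>i. i \<in> {1..p} \<Longrightarrow> l i > 0"
    and "inj_on l {1..p}"
    and "FOU M B p l \<sigma> X"
  shows "integrable M (\<lambda>\<omega>. X 0 \<omega> * X t \<omega>) \<and>
    (\<integral>\<omega>. X 0 \<omega> * X t \<omega> \<partial>M) =
      \<sigma>\<^sup>2 * H / 2 *
        (\<Sum>i\<in>{1..p}. l i powr (2 * real p - 2 * H - 2) /
                       (\<Prod>j\<in>{1..p} - {i}. (l i)\<^sup>2 - (l j)\<^sup>2) *
                     f_cov H (l i * \<bar>t\<bar>))"
proof -
  note M = assms(1) and H = assms(2,3) and B = assms(5) and pos = assms(7) and inj = assms(8)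
  interpret prob_space M by (rule M)
  have B_meas [measurable]: "B t \<in> borel_measurable M" for t
    using B by (simp add: fractional_brownian_motion_def gaussian_process_def)
  obtain N where N: "{\<omega> \<in> space M. \<not> subcubic (\<lambda>t. B t \<omega>)} \<subseteq> N" "emeasure M N = 0" "N \<in> sets M"
    using AE_fbm_subcubic[OF M B] by (rule AE_E)
  \<comment> \<open>A modification on one null set for all times: every path becomes subcubic, so
    the operator identities hold for every outcome.\<close>
  define Y where "Y t \<omega> = (if \<omega> \<in> space M - N then B t \<omega> else 0)" for t \<omega>
  have "AE \<omega> in M. \<omega> \<notin> N" using N by (intro AE_not_in) (auto simp: null_sets_def)
  then have YB: "AE \<omega> in M. \<forall>t. Y t \<omega> = B t \<omega>"
    using AE_space by eventually_elim (auto simp: Y_def)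
  have Y_meas [measurable]: "Y t \<in> borel_measurable M" for t
    unfolding Y_def using N(3) by measurable
  have paths: "subcubic (\<lambda>t. Y t \<omega>)" for \<omega>
    using N(1) subcubicI[of "\<lambda>_. 0" 0] by (cases "\<omega> \<in> space M - N") (auto simp: Y_def)
  have sq: "integrable M (\<lambda>\<omega>. (Y t \<omega>)\<^sup>2)" for t
    using fbm_moments(1)[OF M B, of t] YB by (subst integrable_cong_AE[of _ _ "\<lambda>\<omega>. (B t \<omega>)\<^sup>2"]) auto
  have cov: "(\<integral>\<omega>. Y s \<omega> * Y t \<omega> \<partial>M) = (fbm_var H s + fbm_var H t - fbm_var H (s - t)) / 2" for s t
  proof -
    have "(\<integral>\<omega>. Y s \<omega> * Y t \<omega> \<partial>M) = (\<integral>\<omega>. B s \<omega> * B t \<omega> \<partial>M)"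
      using YB by (intro integral_cong_AE) auto
    then show ?thesis using B by (simp add: fractional_brownian_motion_def fbm_var_def)
  qed
  define S where "S = l ` {1..p}"
  have S: "finite S" "S \<noteq> {}" "\<And>a. a \<in> S \<Longrightarrow> a > 0" "card S = p"
    using assms(6) pos inj by (auto simp: S_def card_image)
  define T where "T a t \<omega> = T_op a (\<lambda>t. Y t \<omega>) t" for a t \<omega>
  define K where "K = pf_coeff S"
  note TL = T_op_paths_cov[OF H Y_meas paths sq cov]
  have T_meas [measurable]: "T a t \<in> borel_measurable M" if "a \<in> S" for a t
    using TL(2)[OF S(3)[OF that] S(3)[OF that]] by (simp add: T_def[abs_def])
  have TT_int: "integrable M (\<lambda>\<omega>. T a 0 \<omega> * T b t \<omega>)" if ab: "a \<in> S" "b \<in> S" for a b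
  proof (rule Bochner_Integration.integrable_bound)
    show "integrable M (\<lambda>\<omega>. (T a 0 \<omega>)\<^sup>2 + (T b t \<omega>)\<^sup>2)"
      using TL(1)[OF S(3) S(3)] ab by (simp add: T_def)
    show "AE \<omega> in M. norm (T a 0 \<omega> * T b t \<omega>) \<le> norm ((T a 0 \<omega>)\<^sup>2 + (T b t \<omega>)\<^sup>2)"
      by (auto simp: abs_mult_le_sum_squares)
  qed (use ab in measurable)
  \<comment> \<open>The exceptional set may depend on t; only the two times 0 and t are combined
    later.\<close>
  have XT: "AE \<omega> in M. X t \<omega> = (\<Sum>a\<in>S. \<sigma> * K a * T a t \<omega>)" for t
  proof -
    have "AE \<omega> in M. X t \<omega> = T_comp l p (\<lambda>s. \<sigma> * B s \<omega>) t" using assms(9) by (simp add: FOU_def)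
    then show ?thesis using YB
    proof eventually_elim
      case (elim \<omega>)
      then have "X t \<omega> = T_comp l p (\<lambda>s. \<sigma> * Y s \<omega>) t" by simp
      also have "\<dots> = (\<Sum>a\<in>S. K a * T_op a (\<lambda>s. \<sigma> * Y s \<omega>) t)"
        unfolding S_def K_def using assms(6) pos inj by (intro T_comp_subcubic subcubic_cmult paths) auto
      also have "\<dots> = (\<Sum>a\<in>S. \<sigma> * K a * T a t \<omega>)"
        by (intro sum.cong refl) (simp add: T_op_cmult[OF paths S(3)] T_def)
      finally show ?case .
    qed
  qed
  let ?XX = "\<lambda>\<omega>. \<Sum>a\<in>S. \<Sum>b\<in>S. \<sigma>\<^sup>2 * K a * K b * (T a 0 \<omega> * T b t \<omega>)"
  have XX: "AE \<omega> in M. X 0 \<omega> * X t \<omega> = ?XX \<omega>"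
    using XT[of 0] XT[of t] by eventually_elim (simp add: sum_product power2_eq_square ac_simps)
  have X_meas [measurable]: "X t \<in> borel_measurable M" for t using assms(9) by (simp add: FOU_def)
  have XX_int: "integrable M ?XX" by (intro Bochner_Integration.integrable_sum integrable_mult_right TT_int)
  have int: "integrable M (\<lambda>\<omega>. X 0 \<omega> * X t \<omega>)"
    using XX_int by (subst integrable_cong_AE[OF _ _ XX]) auto
  define n a where "n c = expmean c (fbm_var H) (- t) - fbm_var H t"
    and "a c = expmean c (fbm_var H) t - fbm_var H t" for c
  have "(\<integral>\<omega>. X 0 \<omega> * X t \<omega> \<partial>M) = (\<integral>\<omega>. ?XX \<omega> \<partial>M)"
    using XX XX_int by (intro integral_cong_AE) auto
  also have "\<dots> = (\<Sum>c\<in>S. \<Sum>b\<in>S. \<sigma>\<^sup>2 * K c * K b * ((c * n c + b * a b) / (2 * (c + b))))"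
    using TT_int by (simp add: Bochner_Integration.integral_sum TL(3)[OF S(3) S(3)] T_def n_def a_def)
  \<comment> \<open>Each summand splits into a part with the mean of rate c and one with the mean of
    rate b. Exchanging the two summations in the second part gives both the same weight
    \<open>c / (c + b)\<close>.\<close>
  also have "\<dots> = (\<Sum>c\<in>S. \<Sum>b\<in>S. \<sigma>\<^sup>2 / 2 * (K c * n c * (K b * (c / (c + b))))) +
      (\<Sum>c\<in>S. \<Sum>b\<in>S. \<sigma>\<^sup>2 / 2 * (K b * a b * (K c * (b / (b + c)))))"
    unfolding sum.distrib[symmetric]
  proof (intro sum.cong refl)
    fix c b assume "c \<in> S" "b \<in> S"
    then have "c + b \<noteq> 0" "b + c \<noteq> 0" using S(3)[of c] S(3)[of b] by auto
    then show "\<sigma>\<^sup>2 * K c * K b * ((c * n c + b * a b) / (2 * (c + b))) =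
      \<sigma>\<^sup>2 / 2 * (K c * n c * (K b * (c / (c + b)))) + \<sigma>\<^sup>2 / 2 * (K b * a b * (K c * (b / (b + c))))"
      by (simp add: divide_simps) (simp add: algebra_simps)
  qed
  also have "(\<Sum>c\<in>S. \<Sum>b\<in>S. \<sigma>\<^sup>2 / 2 * (K b * a b * (K c * (b / (b + c))))) =
      (\<Sum>c\<in>S. \<Sum>b\<in>S. \<sigma>\<^sup>2 / 2 * (K c * a c * (K b * (c / (c + b)))))"
    by (rule sum.swap)
  also have "(\<Sum>c\<in>S. \<Sum>b\<in>S. \<sigma>\<^sup>2 / 2 * (K c * n c * (K b * (c / (c + b))))) + \<dots> =
      (\<Sum>c\<in>S. \<sigma>\<^sup>2 / 2 * (n c + a c) * (K c * (\<Sum>b\<in>S. K b * (c / (c + b)))))"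
    unfolding sum.distrib[symmetric] sum_distrib_left by (intro sum.cong refl) (simp only: algebra_simps)
  also have "\<dots> = (\<Sum>c\<in>S. \<sigma>\<^sup>2 * H / 2 * (c powr (2 * real p - 2 * H - 2) / (\<Prod>b\<in>S - {c}. c\<^sup>2 - b\<^sup>2) * f_cov H (c * \<bar>t\<bar>)))"
  proof (intro sum.cong refl)
    fix c assume c: "c \<in> S"
    have "n c + a c = 2 * H * c powr (- 2 * H) * f_cov H (c * \<bar>t\<bar>)"
      using expmean_fbm_var_f_cov[OF H S(3)[OF c], of t] by (simp add: n_def a_def)
    moreover have "K c * (\<Sum>b\<in>S. K b * (c / (c + b))) = c ^ (2 * (p - 1)) / (\<Prod>b\<in>S - {c}. c\<^sup>2 - b\<^sup>2) / 2"
      using pf_coeff_double_sum[OF S(1-3) c] S(4) by (simp add: K_def)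
    \<comment> \<open>Here \<open>p - 1\<close> is truncated subtraction; p \<ge> 2 makes it agree
      with the real one.\<close>
    moreover have "c powr (2 * real p - 2 * H - 2) = c powr (- 2 * H) * c ^ (2 * (p - 1))"
    proof -
      have "c ^ (2 * (p - 1)) = c powr (2 * real p - 2)"
        using S(3)[OF c] assms(6) by (subst powr_realpow[symmetric]) (auto simp: of_nat_diff algebra_simps)
      then show ?thesis by (simp add: powr_add[symmetric] algebra_simps)
    qed
    ultimately show "\<sigma>\<^sup>2 / 2 * (n c + a c) * (K c * (\<Sum>b\<in>S. K b * (c / (c + b)))) =
        \<sigma>\<^sup>2 * H / 2 * (c powr (2 * real p - 2 * H - 2) / (\<Prod>b\<in>S - {c}. c\<^sup>2 - b\<^sup>2) * f_cov H (c * \<bar>t\<bar>))"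
      by (simp only:) (simp add: ac_simps)
  qed
  also have "\<dots> = (\<Sum>i\<in>{1..p}. \<sigma>\<^sup>2 * H / 2 * (l i powr (2 * real p - 2 * H - 2) /
      (\<Prod>j\<in>{1..p} - {i}. (l i)\<^sup>2 - (l j)\<^sup>2) * f_cov H (l i * \<bar>t\<bar>)))"
    unfolding S_def sum.reindex[OF inj] o_def
  proof (intro sum.cong refl)
    fix i assume i: "i \<in> {1..p}"
    have img: "l ` {1..p} - {l i} = l ` ({1..p} - {i})"
      using inj_on_image_set_diff[OF inj, of "{1..p}" "{i}"] i by auto
    have "(\<Prod>b\<in>l ` {1..p} - {l i}. (l i)\<^sup>2 - b\<^sup>2) = (\<Prod>j\<in>{1..p} - {i}. (l i)\<^sup>2 - (l j)\<^sup>2)"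
      unfolding img by (rule prod.reindex_cong[OF inj_on_subset[OF inj]]) auto
    then show "\<sigma>\<^sup>2 * H / 2 * (l i powr (2 * real p - 2 * H - 2) / (\<Prod>b\<in>l ` {1..p} - {l i}. (l i)\<^sup>2 - b\<^sup>2) * f_cov H (l i * \<bar>t\<bar>)) =
      \<sigma>\<^sup>2 * H / 2 * (l i powr (2 * real p - 2 * H - 2) / (\<Prod>j\<in>{1..p} - {i}. (l i)\<^sup>2 - (l j)\<^sup>2) * f_cov H (l i * \<bar>t\<bar>))"
      by simp
  qed
  finally show ?thesis using int by (simp add: sum_distrib_left)
qed

end
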